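(* Suppose $k\ge1$ and $l\ge1$. Within ${\mathsf{SF}}$, the type $\rho_{k,l+1}$ is not a pseudo-retract of any finite product of types of sublevel $(k,l)$ or lower.
   Context: Types: $\sigma::=\mathbb{N}\mid\sigma\rightarrow\sigma$; $\sigma_0,\ldots,\sigma_{r-1}\rightarrow\mathbb{N}$ abbreviates $\sigma_0\rightarrow\cdots\rightarrow\sigma_{r-1}\rightarrow\mathbb{N}$. Level ${\mathrm{lv}}(\mathbb{N})=0$, ${\mathrm{lv}}(\sigma\rightarrow\tau)=\max({\mathrm{lv}}\,\sigma+1,{\mathrm{lv}}\,\tau)$. Width: $w(\mathbb{N})=0$, $w(\sigma_0,\ldots,\sigma_{r-1}\rightarrow\mathbb{N})=\max(r,w(\sigma_0),\ldots,w(\sigma_{r-1}))$. For $k,l\ge1$, $\sigma$ has sublevel $(k,l)$ if ${\mathrm{lv}}(\sigma)=k$ and $w(\sigma)=l$; $\mathbb{N}$ has sublevel $0$; sublevels are ordered with $0$ lowest and $(k,l)<(k',l')$ iff $k<k'$, or $k=k'$ and $l<l'$. $\rho_{0,l}=\mathbb{N}$, $\rho_{k+1,l}=\rho_{k,l},\ldots,\rho_{k,l}\rightarrow\mathbb{N}$ ($l$ arguments). ${\mathsf{SF}}(\sigma)$ is the set of closed ${\mathrm{PCF}}^\Omega$ terms of type $\sigma$ modulo observational equivalence (${\mathrm{PCF}}^\Omega$: simply typed $\lambda$-calculus over $\mathbb{N}$ with $\underline n,\mathit{suc},\mathit{pre},\mathit{ifzero}$, all $Y_\sigma$, and oracle constants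 $C_f$ for partial $f:\mathbb{N}\rightharpoonup\mathbb{N}$, with its call-by-name operational semantics; $M\simeq M'$ iff every closed context of type $\mathbb{N}$ yields the same numeral, if any, on both); it is an extensional type structure with ${\mathsf{SF}}(\mathbb{N})\cong\mathbb{N}_\bot$. The order $\preceq$ on ${\mathsf{SF}}(\sigma)$: $x\preceq x'$ iff $h\cdot x\sqsubseteq h\cdot x'$ for all $h\in{\mathsf{SF}}(\sigma\rightarrow\mathbb{N})$ (flat order on $\mathbb{N}_\bot$); at function types it is the pointwise order. $\rho$ is a pseudo-retract of the product $\prod_{i<m}\sigma_i$ if there exist $t_i\in{\mathsf{SF}}(\rho\rightarrow\sigma_i)$ ($i<m$) and $r\in{\mathsf{SF}}(\sigma_0\rightarrow\cdots\rightarrow\sigma_{m-1}\rightarrow\rho)$ with $r\cdot(t_0\cdot f)\cdots(t_{m-1}\cdot f)\succeq f$ for all $f\in{\mathsf{SF}}(\rho)$. *)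

theory Defs
  imports Main
begin

datatype ty = TN | TFun ty ty (infixr "\<rightarrow>\<^sub>t" 65)

fun lv :: "ty \<Rightarrow> nat" where
  "lv TN = 0"
| "lv (TFun s t) = max (lv s + 1) (lv t)"

fun args :: "ty \<Rightarrow> ty list" where
  "args TN = []"
| "args (TFun s t) = s # args t"

text \<open>Width: w(N) = 0, w(sigma_0,...,sigma_(r-1) -> N) = max(r, w sigma_0, ..., w sigma_(r-1)),
  written as a structural recursion over the curried arrow.\<close>
fun width :: "ty \<Rightarrow> nat" where
  "width TN = 0"
| "width (TFun s t) = max (Suc (length (args t))) (max (width s) (width t))"

definition sublevel_le :: "ty \<Rightarrow> nat \<Rightarrow> nat \<Rightarrow> bool" where
  "sublevel_le \<sigma> k l \<longleftrightarrow> \<sigma> = TN \<or> lv \<sigma> < k \<or> (lv \<sigma> = k \<and> width \<sigma> \<le> l)"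

fun rho :: "nat \<Rightarrow> nat \<Rightarrow> ty" where
  "rho 0 l = TN"
| "rho (Suc k) l = foldr TFun (replicate l (rho k l)) TN"

definition arrows :: "ty list \<Rightarrow> ty \<Rightarrow> ty" where
  "arrows \<sigma>s \<tau> = foldr TFun \<sigma>s \<tau>"

datatype tm =
    Var nat
  | Lam ty tm
  | App tm tm
  | Num nat
  | SucC
  | PreC
  | IfzC
  | YC ty
  | Orc "nat \<Rightarrow> nat option"

fun lift :: "nat \<Rightarrow> tm \<Rightarrow> tm" where
  "lift k (Var i) = (if i < k then Var i else Var (Suc i))"
| "lift k (Lam \<sigma> t) = Lam \<sigma> (lift (Suc k) t)"
| "lift k (App s t) = App (lift k s) (lift k t)"
| "lift k c = c"

fun subst :: "tm \<Rightarrow> nat \<Rightarrow> tm \<Rightarrow> tm" where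
  "subst (Var i) k s = (if i < k then Var i else if i = k then s else Var (i - 1))"
| "subst (Lam \<sigma> t) k s = Lam \<sigma> (subst t (Suc k) (lift 0 s))"
| "subst (App t u) k s = App (subst t k s) (subst u k s)"
| "subst c k s = c"

inductive typing :: "ty list \<Rightarrow> tm \<Rightarrow> ty \<Rightarrow> bool" where
  T_Var: "i < length \<Gamma> \<Longrightarrow> typing \<Gamma> (Var i) (\<Gamma> ! i)"
| T_Lam: "typing (\<sigma> # \<Gamma>) t \<tau> \<Longrightarrow> typing \<Gamma> (Lam \<sigma> t) (TFun \<sigma> \<tau>)"
| T_App: "typing \<Gamma> s (TFun \<sigma> \<tau>) \<Longrightarrow> typing \<Gamma> t \<sigma> \<Longrightarrow> typing \<Gamma> (App s t) \<tau>"
| T_Num: "typing \<Gamma> (Num n) TN"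
| T_Suc: "typing \<Gamma> SucC (TFun TN TN)"
| T_Pre: "typing \<Gamma> PreC (TFun TN TN)"
| T_Ifz: "typing \<Gamma> IfzC (TFun TN (TFun TN (TFun TN TN)))"
| T_Y: "typing \<Gamma> (YC \<sigma>) (TFun (TFun \<sigma> \<sigma>) \<sigma>)"
| T_Orc: "typing \<Gamma> (Orc f) (TFun TN TN)"

inductive step :: "tm \<Rightarrow> tm \<Rightarrow> bool" where
  s_beta: "step (App (Lam \<sigma> t) u) (subst t 0 u)"
| s_app: "step s s' \<Longrightarrow> step (App s t) (App s' t)"
| s_suc: "step (App SucC (Num n)) (Num (Suc n))"
| s_suc_arg: "step t t' \<Longrightarrow> step (App SucC t) (App SucC t')"
| s_pre: "step (App PreC (Num n)) (Num (n - 1))"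
| s_pre_arg: "step t t' \<Longrightarrow> step (App PreC t) (App PreC t')"
| s_ifz0: "step (App (App (App IfzC (Num 0)) p) q) p"
| s_ifzS: "step (App (App (App IfzC (Num (Suc n))) p) q) q"
| s_ifz_arg: "step t t' \<Longrightarrow> step (App IfzC t) (App IfzC t')"
| s_Y: "step (App (YC \<sigma>) t) (App t (App (YC \<sigma>) t))"
| s_orc: "f n = Some v \<Longrightarrow> step (App (Orc f) (Num n)) (Num v)"
| s_orc_arg: "step t t' \<Longrightarrow> step (App (Orc f) t) (App (Orc f) t')"

definition evals :: "tm \<Rightarrow> nat \<Rightarrow> bool" where
  "evals M n \<longleftrightarrow> step\<^sup>*\<^sup>* M (Num n)"

text \<open>Elements of SF(sigma) are represented by closed terms of type sigma; application in SF
  is term application. x \<preceq> x' iff h x \<sqsubseteq> h x' (flat order on N_bot) for all closed h : sigma -> N.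
  All notions below respect observational equivalence, so they are well defined on SF.\<close>
definition sf_le :: "ty \<Rightarrow> tm \<Rightarrow> tm \<Rightarrow> bool" where
  "sf_le \<sigma> x x' \<longleftrightarrow>
     (\<forall>h n. typing [] h (TFun \<sigma> TN) \<longrightarrow> evals (App h x) n \<longrightarrow> evals (App h x') n)"

definition pseudo_retract :: "ty \<Rightarrow> ty list \<Rightarrow> bool" where
  "pseudo_retract \<rho> \<sigma>s \<longleftrightarrow>
     (\<exists>ts r. length ts = length \<sigma>s
        \<and> (\<forall>i < length \<sigma>s. typing [] (ts ! i) (TFun \<rho> (\<sigma>s ! i)))
        \<and> typing [] r (arrows \<sigma>s \<rho>)
        \<and> (\<forall>f. typing [] f \<rho> \<longrightarrow> sf_le \<rho> f (foldl App r (map (\<lambda>t. App t f) ts))))"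

end

theory Submission
  imports Defs
begin

text \<open>
  Suppose \<open>\<rho>\<^sub>k\<^sub>,\<^sub>l\<^sub>+\<^sub>1\<close> is a pseudo-retract via \<open>t\<^sub>i\<close> and \<open>r\<close>. Evaluate \<open>r (t\<^sub>0 X) \<dots> (t\<^sub>n X) Z\<^sub>0 \<dots> Z\<^sub>l\<close>
  symbolically. Instantiating \<open>X\<close> by constant functions and the \<open>Z\<^sub>i\<close> by undefined terms shows that
  the evaluation gets stuck at a call \<open>X P\<^sub>0 \<dots> P\<^sub>l\<close>. Instantiating \<open>X\<close> by test functions shows that
  \<open>P\<^sub>j[X := 0] \<succeq> Z\<^sub>j\<close>, where 0 is the constant function. The call is issued by the code of some
  \<open>t\<^sub>i\<close>, and this code knows the \<open>Z\<^sub>j\<close> only through the arguments passed to it by \<open>r\<close>, whose types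
  have sublevel at most \<open>(k - 1, l)\<close>. Hence \<open>\<rho>\<^sub>k\<^sub>-\<^sub>1\<^sub>,\<^sub>l\<^sub>+\<^sub>1\<close> is again a pseudo-retract of a product of types
  of lower sublevel, and one descends to \<open>k = 1\<close>. There at most \<open>l\<close> arguments of type \<open>N\<close> are
  passed, from which \<open>l + 1\<close> elements of the flat domain cannot be reconstructed, because chains in
  the \<open>l\<close>-th power of the flat domain are too short.\<close>

section \<open>Operational semantics of PCF\<close>

lemma typing_closed:
  "typing \<Gamma> M \<tau> \<Longrightarrow> length \<Gamma> \<le> k \<Longrightarrow> lift k M = M \<and> subst M k s = M"
  by (induction arbitrary: k s rule: typing.induct) auto

definition closed :: "tm \<Rightarrow> bool" where
  "closed M \<longleftrightarrow> (\<forall>k s. lift k M = M \<and> subst M k s = M)"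

lemma closedD: "closed M \<Longrightarrow> lift k M = M" "closed M \<Longrightarrow> subst M k s = M"
  by (auto simp: closed_def)

lemma typing_imp_closed: "typing [] M \<tau> \<Longrightarrow> closed M"
  using typing_closed[of "[]"] by (auto simp: closed_def)

inductive_cases typing_VarE: "typing \<Gamma> (Var i) \<tau>"
inductive_cases typing_LamE: "typing \<Gamma> (Lam \<sigma> b) \<tau>"
inductive_cases typing_AppE: "typing \<Gamma> (App s t) \<tau>"
inductive_cases typing_constE: "typing \<Gamma> (Num n) \<tau>" "typing \<Gamma> SucC \<tau>" "typing \<Gamma> PreC \<tau>"
  "typing \<Gamma> IfzC \<tau>" "typing \<Gamma> (YC \<sigma>) \<tau>" "typing \<Gamma> (Orc f) \<tau>"

lemmas typing_elims = typing_VarE typing_LamE typing_AppE typing_constE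

lemma typing_weaken: "typing \<Gamma> M \<tau> \<Longrightarrow> typing (\<Gamma> @ \<Delta>) M \<tau>"
proof (induction rule: typing.induct)
  case (T_Var i \<Gamma>)
  then show ?case using typing.T_Var[of i "\<Gamma> @ \<Delta>"] by (simp add: nth_append)
qed (auto intro: typing.intros)

lemma typing_subst:
  "typing \<Gamma>' M \<tau> \<Longrightarrow> \<Gamma>' = \<Gamma> @ [\<sigma>] \<Longrightarrow> typing [] u \<sigma> \<Longrightarrow> typing \<Gamma> (subst M (length \<Gamma>) u) \<tau>"
proof (induction arbitrary: \<Gamma> rule: typing.induct)
  case (T_Var i \<Gamma>')
  show ?case
  proof (cases "i < length \<Gamma>")
    case True
    then show ?thesis using T_Var typing.T_Var[of i \<Gamma>] by (simp add: nth_append)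
  next
    case False
    then have "i = length \<Gamma>" using T_Var by simp
    then show ?thesis using T_Var typing_weaken[of "[]" u \<sigma> \<Gamma>] by simp
  qed
next
  case (T_Lam \<sigma>' \<Gamma>' t \<tau>)
  then show ?case
    using T_Lam.IH[of "\<sigma>' # \<Gamma>"] closedD(1)[OF typing_imp_closed]
    by (auto intro!: typing.T_Lam)
qed (auto intro: typing.intros)

lemma subject_reduction: "step M M' \<Longrightarrow> typing [] M \<tau> \<Longrightarrow> typing [] M' \<tau>"
proof (induction arbitrary: \<tau> rule: step.induct)
  case (s_beta \<sigma> t u)
  then show ?case
    using typing_subst[of "[\<sigma>]" t \<tau> "[]" \<sigma> u] by (auto elim!: typing_elims)
qed (auto elim!: typing_elims intro: typing.intros)

section \<open>Determinism of reduction and evaluation\<close>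

inductive_cases step_AppE: "step (App s t) N"
inductive_cases step_valE: "step (Num n) N" "step SucC N" "step PreC N" "step IfzC N"
  "step (YC \<sigma>) N" "step (Orc f) N" "step (Lam \<sigma> b) N" "step (Var i) N"
inductive_cases step_IfzE: "step (App IfzC t) N"

lemma no_step [simp]:
  "\<not> step (Num n) N" "\<not> step SucC N" "\<not> step PreC N" "\<not> step IfzC N" "\<not> step (YC \<sigma>) N"
  "\<not> step (Orc f) N" "\<not> step (Lam \<sigma> b) N" "\<not> step (Var i) N"
  by (auto elim: step_valE)

lemma no_step_Ifz [simp]: "\<not> step (App IfzC (Num n)) N" "\<not> step (App (App IfzC (Num n)) p) N"
proof -
  show *: "\<not> step (App IfzC (Num n)) N" for N
    by (rule notI, erule step_AppE) auto
  show "\<not> step (App (App IfzC (Num n)) p) N"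
    by (rule notI, erule step_AppE) (auto simp: *)
qed

lemma step_det: "step M N \<Longrightarrow> step M N' \<Longrightarrow> N = N'"
proof (induction arbitrary: N' rule: step.induct)
  case (s_beta \<sigma> t u)
  then show ?case by (auto elim: step_AppE)
next
  case (s_app s s' t)
  from s_app.prems show ?case by (rule step_AppE; (use s_app.hyps in \<open>simp; fail\<close>)?) (metis s_app.IH)
next
  case (s_suc n)
  then show ?case by (auto elim: step_AppE)
next
  case (s_suc_arg t t')
  from s_suc_arg.prems show ?case by (rule step_AppE; (use s_suc_arg.hyps in \<open>simp; fail\<close>)?) (metis s_suc_arg.IH)
next
  case (s_pre n)
  then show ?case by (auto elim: step_AppE)
next
  case (s_pre_arg t t')
  from s_pre_arg.prems show ?case by (rule step_AppE; (use s_pre_arg.hyps in \<open>simp; fail\<close>)?) (metis s_pre_arg.IH)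
next
  case (s_ifz0 p q)
  from s_ifz0.prems show ?case by (rule step_AppE) auto
next
  case (s_ifzS n p q)
  from s_ifzS.prems show ?case by (rule step_AppE) auto
next
  case (s_ifz_arg t t')
  from s_ifz_arg.prems show ?case by (rule step_AppE; (use s_ifz_arg.hyps in \<open>simp; fail\<close>)?) (metis s_ifz_arg.IH)
next
  case (s_Y \<sigma> t)
  then show ?case by (auto elim: step_AppE)
next
  case (s_orc f n v)
  then show ?case by (auto elim: step_AppE)
next
  case (s_orc_arg t t' f)
  from s_orc_arg.prems show ?case by (rule step_AppE; (use s_orc_arg.hyps in \<open>simp; fail\<close>)?) (metis s_orc_arg.IH)
qed

lemma evals_step: "step M M' \<Longrightarrow> evals M n \<longleftrightarrow> evals M' n"
  unfolding evals_def
  by (metis converse_rtranclpE converse_rtranclp_into_rtranclp step_det step_valE(1))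

lemma evals_steps: "step\<^sup>*\<^sup>* M M' \<Longrightarrow> evals M n \<longleftrightarrow> evals M' n"
  by (induction rule: rtranclp_induct) (auto dest: evals_step)

lemma evals_Num: "evals (Num m) n \<longleftrightarrow> m = n"
  unfolding evals_def by (metis converse_rtranclpE rtranclp.rtrancl_refl step_valE(1) tm.inject(4))

lemma steps_head: "step\<^sup>*\<^sup>* s s' \<Longrightarrow> step\<^sup>*\<^sup>* (App s t) (App s' t)"
  by (induction rule: rtranclp_induct) (auto intro: rtranclp.rtrancl_into_rtrancl s_app)

section \<open>Strict constants and the operational precongruence\<close>

definition strict :: "tm \<Rightarrow> bool" where
  "strict f \<longleftrightarrow> f = SucC \<or> f = PreC \<or> f = IfzC \<or> (\<exists>g. f = Orc g)"

lemma step_strict_arg: "strict f \<Longrightarrow> step t t' \<Longrightarrow> step (App f t) (App f t')"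
  by (auto simp: strict_def intro: step.intros)

lemma steps_strict_arg: "step\<^sup>*\<^sup>* t t' \<Longrightarrow> strict f \<Longrightarrow> step\<^sup>*\<^sup>* (App f t) (App f t')"
  by (induction rule: rtranclp_induct) (auto intro: rtranclp.rtrancl_into_rtrancl step_strict_arg)

lemma steps_foldl: "step\<^sup>*\<^sup>* s s' \<Longrightarrow> step\<^sup>*\<^sup>* (foldl App s ts) (foldl App s' ts)"
  by (induction ts arbitrary: s s') (auto intro: steps_head)

text \<open>An operational precongruence. Rule \<open>sim_base\<close> is extensionality at the base type; rule
  \<open>sim_orc\<close> makes a test function whose only possible value is 0 smaller than the constant
  function 0, although the argument of the test may be open.\<close>
inductive sim :: "tm \<Rightarrow> tm \<Rightarrow> bool" where
  sim_base: "typing [] A TN \<Longrightarrow> typing [] A' TN \<Longrightarrow> (\<And>n. evals A n \<Longrightarrow> evals A' n) \<Longrightarrow> sim A A'"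
| sim_orc: "ran g \<subseteq> {0} \<Longrightarrow> sim (App (Orc g) A) (Num 0)"
| sim_App: "sim s s' \<Longrightarrow> sim t t' \<Longrightarrow> sim (App s t) (App s' t')"
| sim_Lam: "sim t t' \<Longrightarrow> sim (Lam \<sigma> t) (Lam \<sigma> t')"
| sim_Var: "sim (Var i) (Var i)"
| sim_Num: "sim (Num n) (Num n)"
| sim_Suc: "sim SucC SucC"
| sim_Pre: "sim PreC PreC"
| sim_Ifz: "sim IfzC IfzC"
| sim_Y: "sim (YC \<sigma>) (YC \<sigma>)"
| sim_Orc: "sim (Orc f) (Orc f)"

inductive_cases sim_AppE: "sim (App s t) N"
inductive_cases sim_constE: "sim SucC N" "sim PreC N" "sim IfzC N"
  "sim (YC \<sigma>) N" "sim (Orc f) N" "sim (Lam \<sigma> b) N"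
inductive_cases sim_NumE: "sim (Num n) N"

lemma sim_refl: "sim M M"
  by (induction M) (auto intro: sim.intros)

lemma sim_lift: "sim M M' \<Longrightarrow> sim (lift k M) (lift k M')"
proof (induction arbitrary: k rule: sim.induct)
  case (sim_base A A')
  then show ?case
    using closedD(1)[OF typing_imp_closed] by (auto intro!: sim.sim_base)
qed (auto intro: sim.intros)

lemma sim_subst: "sim M M' \<Longrightarrow> sim s s' \<Longrightarrow> sim (subst M k s) (subst M' k s')"
proof (induction arbitrary: k s s' rule: sim.induct)
  case (sim_base A A')
  then show ?case
    using closedD(2)[OF typing_imp_closed] by (auto intro!: sim.sim_base)
next
  case (sim_Lam t t' \<sigma>)
  then show ?case by (simp add: sim.sim_Lam sim_lift)
qed (auto intro: sim.intros)

lemma sim_NumD: "sim (Num n) N \<Longrightarrow> step\<^sup>*\<^sup>* N (Num n)"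
  by (erule sim_NumE) (auto simp: evals_Num, simp add: evals_def)

text \<open>A strict constant has a function type and is not an application, so neither
  \<open>sim_base\<close> nor \<open>sim_orc\<close> applies to it.\<close>

lemma sim_strictD: "sim s s' \<Longrightarrow> strict s \<Longrightarrow> s' = s"
  by (auto simp: strict_def elim: sim_constE typing_elims)

lemma sim_IfzD:
  assumes "sim (App (App IfzC (Num n)) p) s'"
  shows "\<exists>n' p'. s' = App (App IfzC n') p' \<and> step\<^sup>*\<^sup>* n' (Num n) \<and> sim p p'"
proof -
  from assms obtain u p' where s': "s' = App u p'" "sim (App IfzC (Num n)) u" "sim p p'"
    by (rule sim_AppE) (auto elim!: typing_elims)
  from s'(2) obtain i n' where u: "u = App i n'" "sim IfzC i" "sim (Num n) n'"
    by (rule sim_AppE) (auto elim!: typing_elims)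
  then have "u = App IfzC n'" "sim (Num n) n'"
    using sim_strictD[of IfzC] by (auto simp: strict_def)
  then show ?thesis using s' sim_NumD by blast
qed

lemma ifz_steps: "step\<^sup>*\<^sup>* n n' \<Longrightarrow> step\<^sup>*\<^sup>* (App (App (App IfzC n) p) q) (App (App (App IfzC n') p) q)"
  by (intro steps_head steps_strict_arg) (auto simp: strict_def)

text \<open>For \<open>sim_base\<close> the right-hand term need not move, since a step on the left
  does not change what it evaluates to. For \<open>sim_orc\<close> an answering oracle can only
  yield 0. In the congruence cases the head or numeral that forms the redex recurs on the right
  after finitely many steps.\<close>

lemma sim_step: "sim M M' \<Longrightarrow> step M N \<Longrightarrow> \<exists>N'. step\<^sup>*\<^sup>* M' N' \<and> sim N N'"
proof (induction arbitrary: N rule: sim.induct)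
  case (sim_base A A')
  then show ?case
    by (metis evals_step rtranclp.rtrancl_refl sim.sim_base subject_reduction)
next
  case (sim_orc g A)
  from sim_orc(2) show ?case
    by (rule step_AppE) (use sim_orc(1) in \<open>auto elim: step_valE intro!: exI[of _ "Num 0"]
        intro: sim.sim_orc[OF sim_orc(1)] sim.sim_Num simp: ran_def\<close>)
next
  case (sim_App s s' t t')
  have strict_arg: "\<exists>N'. step\<^sup>*\<^sup>* (App s' t') N' \<and> sim (App s u) N'"
    if "strict s" "step t u" for u
  proof -
    obtain u' where "step\<^sup>*\<^sup>* t' u'" "sim u u'" using sim_App.IH(2) \<open>step t u\<close> by blast
    then show ?thesis
      using steps_strict_arg[of t' u' s'] sim_strictD[OF sim_App.hyps(1) \<open>strict s\<close>] \<open>strict s\<close>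
      by (metis sim.sim_App sim_refl)
  qed
  have strict_num: "step\<^sup>*\<^sup>* (App s' t') (App s (Num n))" if "strict s" "t = Num n" for n
    using sim_strictD[OF sim_App.hyps(1)] sim_NumD[of n t'] sim_App.hyps(2) steps_strict_arg that
    by blast
  from sim_App.prems show ?case
  proof (cases rule: step.cases)
    case (s_beta \<sigma> b)
    from sim_App.hyps(1)[unfolded s_beta] obtain b' where "s' = Lam \<sigma> b'" "sim b b'"
      by (auto elim: sim_constE typing_elims)
    then show ?thesis
      using s_beta sim_subst[OF _ sim_App.hyps(2)] step.s_beta r_into_rtranclp[of step] by metis
  next
    case (s_app u)
    then obtain u' where "step\<^sup>*\<^sup>* s' u'" "sim u u'" using sim_App.IH(1) by blast
    then show ?thesis
      using s_app sim.sim_App[OF _ sim_App.hyps(2)] steps_head by blast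
  next
    case (s_suc n)
    then show ?thesis
      using strict_num[of n] step.s_suc[of n] sim.sim_Num
      by (metis rtranclp.rtrancl_into_rtrancl strict_def)
  next
    case (s_pre n)
    then show ?thesis
      using strict_num[of n] step.s_pre[of n] sim.sim_Num
      by (metis rtranclp.rtrancl_into_rtrancl strict_def)
  next
    case (s_orc f n v)
    then show ?thesis
      using strict_num[of n] step.s_orc[of f n v] sim.sim_Num
      by (metis rtranclp.rtrancl_into_rtrancl strict_def)
  next
    case (s_ifz0 )
    from sim_App.hyps(1)[unfolded s_ifz0] show ?thesis
      by (metis (no_types, lifting) ifz_steps rtranclp.rtrancl_into_rtrancl sim_IfzD step.s_ifz0)
  next
    case (s_ifzS n p)
    from sim_App.hyps(1)[unfolded s_ifzS] obtain n' p' where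
      s': "s' = App (App IfzC n') p'" "step\<^sup>*\<^sup>* n' (Num (Suc n))" by (blast dest: sim_IfzD)
    have "step\<^sup>*\<^sup>* (App s' t') t'"
      using ifz_steps[OF s'(2)] step.s_ifzS s'(1) rtranclp.rtrancl_into_rtrancl by metis
    then show ?thesis using sim_App.hyps(2) s_ifzS by blast
  next
    case (s_Y \<sigma>)
    then have "s' = YC \<sigma>" using sim_App.hyps(1) by (auto elim: sim_constE typing_elims)
    then show ?thesis
      using s_Y sim_App.hyps(2) step.s_Y[of \<sigma> t'] r_into_rtranclp[of step]
      by (metis sim.sim_App sim.sim_Y)
  qed (use strict_arg in \<open>auto simp: strict_def\<close>)
qed (auto elim: step_valE)

lemma sim_evals: "sim M M' \<Longrightarrow> evals M n \<Longrightarrow> evals M' n"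
proof -
  have "step\<^sup>*\<^sup>* M N \<Longrightarrow> sim M M' \<Longrightarrow> \<exists>N'. step\<^sup>*\<^sup>* M' N' \<and> sim N N'" for N
    by (induction rule: rtranclp_induct) (blast, meson rtranclp_trans sim_step)
  then show "sim M M' \<Longrightarrow> evals M n \<Longrightarrow> evals M' n"
    unfolding evals_def by (meson rtranclp_trans sim_NumD)
qed

section \<open>Evaluation positions, values and divergence\<close>

inductive in_eval_pos :: "tm \<Rightarrow> tm \<Rightarrow> bool" where
  here: "in_eval_pos N N"
| head: "in_eval_pos N M \<Longrightarrow> in_eval_pos N (App M Q)"
| arg: "in_eval_pos N M \<Longrightarrow> strict f \<Longrightarrow> in_eval_pos N (App f M)"

text \<open>Partial applications of \<open>IfzC\<close> count as values even if their first argument can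
  still be reduced.\<close>
fun val :: "tm \<Rightarrow> bool" where
  "val (App IfzC _) = True"
| "val (App (App IfzC _) _) = True"
| "val (App _ _) = False"
| "val _ = True"

inductive_cases in_eval_pos_AppE: "in_eval_pos N (App s t)"
inductive_cases in_eval_pos_valE: "in_eval_pos N (Num n)" "in_eval_pos N SucC" "in_eval_pos N PreC"
  "in_eval_pos N IfzC" "in_eval_pos N (YC \<sigma>)" "in_eval_pos N (Orc f)" "in_eval_pos N (Lam \<sigma> b)"

text \<open>A redex of \<open>M\<close> not contained in \<open>N\<close> would need
  \<open>N\<close> to be an abstraction, a constant, a numeral or a partial conditional, all of
  which are values. Hence the step takes place inside \<open>N\<close>.\<close>

lemma in_eval_pos_step:
  "in_eval_pos N M \<Longrightarrow> \<not> val N \<Longrightarrow> step M M' \<Longrightarrow> \<exists>N'. step N N' \<and> in_eval_pos N' M'"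
proof (induction arbitrary: M' rule: in_eval_pos.induct)
  case (here N)
  then show ?case using in_eval_pos.here by blast
next
  case (head N M Q)
  from head.prems(2) show ?case
  proof (cases rule: step.cases)
    case (s_app s')
    then show ?thesis using head in_eval_pos.head by blast
  qed (use head.hyps head.prems in \<open>auto elim!: in_eval_pos_AppE elim: in_eval_pos_valE simp: strict_def\<close>)
next
  case (arg N M f)
  have "\<exists>N'. step N N' \<and> in_eval_pos N' (App f u)" if "step M u" for u
    using arg in_eval_pos.arg that by blast
  with arg.prems(2) arg.hyps show ?case
    by (cases rule: step.cases)
      (use arg.prems(1) in \<open>auto elim: in_eval_pos_valE step_valE simp: strict_def\<close>)
qed

text \<open>A numeral has no evaluation position but itself, so the reduction of \<open>M\<close>
  cannot end before the subterm has become a value.\<close>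

lemma in_eval_pos_val:
  assumes "in_eval_pos N M" "evals M n"
  shows "\<exists>V. step\<^sup>*\<^sup>* N V \<and> val V"
proof -
  from assms(2) have "step\<^sup>*\<^sup>* M (Num n)" by (simp add: evals_def)
  then show ?thesis using assms(1)
  proof (induction arbitrary: N rule: converse_rtranclp_induct)
    case base
    then show ?case by (auto elim: in_eval_pos_valE)
  next
    case (step M M')
    then show ?case
      by (metis in_eval_pos_step converse_rtranclp_into_rtranclp rtranclp.rtrancl_refl)
  qed
qed

lemma val_step: "step V V' \<Longrightarrow> val V \<Longrightarrow> val V'"
  by (induction rule: step.induct) (auto elim!: val.elims step_IfzE)

text \<open>If \<open>N\<close> lies beyond \<open>V\<close>, \<open>val_step\<close> is needed
  because a partial conditional may still reduce; otherwise determinism puts \<open>V\<close> on the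
  path from \<open>N\<close>.\<close>

lemma val_steps:
  assumes "step\<^sup>*\<^sup>* M N" "step\<^sup>*\<^sup>* M V" "val V"
  shows "\<exists>W. step\<^sup>*\<^sup>* N W \<and> val W"
  using assms
proof (induction rule: rtranclp_induct)
  case (step N N')
  then obtain W where W: "step\<^sup>*\<^sup>* N W" "val W" by blast
  from W(1) show ?case
  proof (cases rule: converse_rtranclpE)
    case base
    then show ?thesis using W val_step step(2) by blast
  next
    case (step N'')
    then show ?thesis using W \<open>step N N'\<close> step_det by blast
  qed
qed blast

definition omega :: "ty \<Rightarrow> tm" where
  "omega \<tau> = App (YC \<tau>) (Lam \<tau> (Var 0))"

lemma typing_omega: "typing [] (omega \<tau>) \<tau>"
  using typing.T_Var[of 0 "[\<tau>]"] by (auto simp: omega_def intro!: typing.intros)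

lemma omega_not_val:
  assumes "step\<^sup>*\<^sup>* (omega \<tau>) V"
  shows "\<not> val V"
proof -
  from assms have "V = omega \<tau> \<or> V = App (Lam \<tau> (Var 0)) (omega \<tau>)"
    by (induction rule: rtranclp_induct) (auto simp: omega_def elim!: step_AppE elim: step_valE)
  then show ?thesis by (auto simp: omega_def)
qed

lemma not_evals_omega: "\<not> evals (omega \<tau>) n"
  using omega_not_val by (force simp: evals_def)

lemma orc_val:
  assumes "step\<^sup>*\<^sup>* (App (Orc g) A) V" "val V"
  shows "\<exists>a. evals A a \<and> g a \<noteq> None"
proof -
  \<comment> \<open>Until the oracle answers, each reduct is still the oracle applied to a reduct of
    \<open>A\<close>, hence not a value.\<close>
  have "step\<^sup>*\<^sup>* (App (Orc g) A) V \<Longrightarrow> (\<exists>a. evals A a \<and> g a \<noteq> None) \<or> (\<exists>A'. step\<^sup>*\<^sup>* A A' \<and> V = App (Orc g) A')" for V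
  proof (induction rule: rtranclp_induct)
    case (step M M')
    then consider "\<exists>a. evals A a \<and> g a \<noteq> None" | A' where "step\<^sup>*\<^sup>* A A'" "M = App (Orc g) A'"
      by blast
    then show ?case
    proof cases
      case 2
      from step(2)[unfolded 2] show ?thesis
        by (cases rule: step.cases)
          (use 2 in \<open>auto simp: evals_def elim: step_valE intro: rtranclp.rtrancl_into_rtrancl\<close>)
    qed blast
  qed blast
  from this[OF assms(1)] assms(2) show ?thesis by auto
qed

section \<open>Iterated application and abstraction\<close>

lemma subst_foldl: "subst (foldl App a zs) k u = foldl App (subst a k u) (map (\<lambda>z. subst z k u) zs)"
  by (induction zs arbitrary: a) auto

lemma typing_foldl:
  "typing \<Gamma> s (arrows \<sigma>s \<tau>) \<Longrightarrow> list_all2 (typing \<Gamma>) ts \<sigma>s \<Longrightarrow> typing \<Gamma> (foldl App s ts) \<tau>"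
proof (induction ts arbitrary: s \<sigma>s)
  case (Cons t ts)
  then obtain \<sigma> \<sigma>s' where "\<sigma>s = \<sigma> # \<sigma>s'" by (cases \<sigma>s) auto
  then show ?case using Cons by (auto simp: arrows_def intro: typing.T_App)
qed (simp add: arrows_def)

lemma sf_le_apply:
  assumes "sf_le \<rho> f F" "\<rho> = arrows \<sigma>s TN" "list_all2 (typing []) zs \<sigma>s" "evals (foldl App f zs) n"
  shows "evals (foldl App F zs) n"
proof -
  \<comment> \<open>This observation applies its argument to the fixed closed terms
    \<open>zs\<close>.\<close>
  define h where "h = Lam \<rho> (foldl App (Var 0) zs)"
  have "map (\<lambda>z. subst z 0 u) zs = zs" for u
    using assms(3) by (intro map_idI)
      (metis closedD(2) in_set_conv_nth list_all2_conv_all_nth typing_imp_closed)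
  then have st: "step (App h u) (foldl App u zs)" for u
    using s_beta[of \<rho> "foldl App (Var 0) zs" u] by (simp add: h_def subst_foldl)
  have "list_all2 (typing [\<rho>]) zs \<sigma>s"
    using assms(3) typing_weaken[of "[]" _ _ "[\<rho>]"] by (auto simp: list_all2_conv_all_nth)
  then have "typing [] h (TFun \<rho> TN)"
    unfolding h_def using typing.T_Var[of 0 "[\<rho>]"] assms(2)
    by (intro typing.T_Lam typing_foldl[of _ _ \<sigma>s]) auto
  then show ?thesis using assms(1,4) evals_step[OF st] by (auto simp: sf_le_def)
qed

abbreviation lams :: "ty list \<Rightarrow> tm \<Rightarrow> tm" where
  "lams \<sigma>s b \<equiv> foldr Lam \<sigma>s b"

lemma subst_lams:
  "closed s \<Longrightarrow> subst (lams \<sigma>s b) k s = lams \<sigma>s (subst b (k + length \<sigma>s) s)"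
  by (induction \<sigma>s arbitrary: k) (auto simp: closedD)

lemma typing_lams:
  "typing (rev \<sigma>s @ \<Gamma>) b \<tau> \<Longrightarrow> typing \<Gamma> (lams \<sigma>s b) (arrows \<sigma>s \<tau>)"
  by (induction \<sigma>s arbitrary: \<Gamma>) (auto simp: arrows_def intro!: T_Lam)

lemma lams_closed_beta:
  "closed b \<Longrightarrow> length zs = length \<sigma>s \<Longrightarrow> \<forall>z \<in> set zs. closed z \<Longrightarrow>
    step\<^sup>*\<^sup>* (foldl App (lams \<sigma>s b) zs) b"
proof (induction \<sigma>s arbitrary: zs)
  case (Cons \<sigma> \<sigma>s)
  then obtain z zs' where zs: "zs = z # zs'" by (cases zs) auto
  have "step\<^sup>*\<^sup>* (foldl App (App (lams (\<sigma> # \<sigma>s) b) z) zs') (foldl App (lams \<sigma>s b) zs')"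
    using Cons.prems zs step.s_beta[of \<sigma> "lams \<sigma>s b" z]
    by (intro steps_foldl r_into_rtranclp) (simp add: subst_lams closedD)
  then show ?case using Cons zs by (auto intro: rtranclp_trans)
qed simp

text \<open>Argument \<open>c\<close>, counted from the outermost binder, has de Bruijn index
  \<open>length \<sigma>s - 1 - c\<close>. The body has the shape of the test functions in
  \<open>factor\<close>.\<close>

lemma lams_proj_beta:
  assumes "closed g" "closed h"
  shows "c < length \<sigma>s \<Longrightarrow> length zs = length \<sigma>s \<Longrightarrow> \<forall>z \<in> set zs. closed z \<Longrightarrow>
    step\<^sup>*\<^sup>* (foldl App (lams \<sigma>s (App g (App h (Var (length \<sigma>s - 1 - c))))) zs) (App g (App h (zs ! c)))"
proof (induction \<sigma>s arbitrary: zs c)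
  case (Cons \<sigma> \<sigma>s)
  let ?B = "\<lambda>v. App g (App h v)"
  obtain z zs' where zs: "zs = z # zs'" using Cons.prems by (cases zs) auto
  have cl: "closed z" using Cons.prems zs by auto
  have *: "step\<^sup>*\<^sup>* (foldl App (lams (\<sigma> # \<sigma>s) b) zs) (foldl App (lams \<sigma>s (subst b (length \<sigma>s) z)) zs')" for b
    using step.s_beta[of \<sigma> "lams \<sigma>s b" z] steps_foldl[OF r_into_rtranclp[of step]] zs
    by (simp add: subst_lams[OF cl])
  show ?case
  proof (cases c)
    case 0
    have "step\<^sup>*\<^sup>* (foldl App (lams \<sigma>s (?B z)) zs') (?B z)"
      using Cons.prems zs assms by (intro lams_closed_beta) (auto simp: closed_def)
    then show ?thesis
      using *[of "?B (Var (length \<sigma>s))"] 0 zs assms by (auto simp: closedD intro: rtranclp_trans)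
  next
    case (Suc c')
    have "step\<^sup>*\<^sup>* (foldl App (lams \<sigma>s (?B (Var (length \<sigma>s - 1 - c')))) zs') (?B (zs' ! c'))"
      using Cons.IH[of c' zs'] Cons.prems zs Suc by auto
    then show ?thesis
      using *[of "?B (Var (length \<sigma>s - 1 - c'))"] Suc zs assms Cons.prems
      by (auto simp: closedD intro: rtranclp_trans split: if_splits)
  qed
qed simp

lemma sim_lams: "sim b b' \<Longrightarrow> sim (lams \<sigma>s b) (lams \<sigma>s b')"
  by (induction \<sigma>s) (auto intro: sim.intros)

section \<open>Terms with named constants\<close>

text \<open>PCF terms with named constants \<open>Cst i\<close>. The constants stand for closed terms to be
  supplied later, so instantiating them involves no shifting of de Bruijn indices.\<close>
datatype ctm =
    CVar nat
  | CLam ty ctm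
  | CApp ctm ctm
  | CNum nat
  | CSuc
  | CPre
  | CIfz
  | CY ty
  | COrc "nat \<Rightarrow> nat option"
  | Cst nat

fun clift :: "nat \<Rightarrow> ctm \<Rightarrow> ctm" where
  "clift k (CVar i) = (if i < k then CVar i else CVar (Suc i))"
| "clift k (CLam \<sigma> t) = CLam \<sigma> (clift (Suc k) t)"
| "clift k (CApp s t) = CApp (clift k s) (clift k t)"
| "clift k c = c"

fun csubst :: "ctm \<Rightarrow> nat \<Rightarrow> ctm \<Rightarrow> ctm" where
  "csubst (CVar i) k s = (if i < k then CVar i else if i = k then s else CVar (i - 1))"
| "csubst (CLam \<sigma> t) k s = CLam \<sigma> (csubst t (Suc k) (clift 0 s))"
| "csubst (CApp t u) k s = CApp (csubst t k s) (csubst u k s)"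
| "csubst c k s = c"

inductive ctyping :: "(nat \<Rightarrow> ty option) \<Rightarrow> ty list \<Rightarrow> ctm \<Rightarrow> ty \<Rightarrow> bool" for D where
  C_Var: "i < length \<Gamma> \<Longrightarrow> ctyping D \<Gamma> (CVar i) (\<Gamma> ! i)"
| C_Lam: "ctyping D (\<sigma> # \<Gamma>) t \<tau> \<Longrightarrow> ctyping D \<Gamma> (CLam \<sigma> t) (TFun \<sigma> \<tau>)"
| C_App: "ctyping D \<Gamma> s (TFun \<sigma> \<tau>) \<Longrightarrow> ctyping D \<Gamma> t \<sigma> \<Longrightarrow> ctyping D \<Gamma> (CApp s t) \<tau>"
| C_Num: "ctyping D \<Gamma> (CNum n) TN"
| C_Suc: "ctyping D \<Gamma> CSuc (TFun TN TN)"
| C_Pre: "ctyping D \<Gamma> CPre (TFun TN TN)"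
| C_Ifz: "ctyping D \<Gamma> CIfz (TFun TN (TFun TN (TFun TN TN)))"
| C_Y: "ctyping D \<Gamma> (CY \<sigma>) (TFun (TFun \<sigma> \<sigma>) \<sigma>)"
| C_Orc: "ctyping D \<Gamma> (COrc f) (TFun TN TN)"
| C_Cst: "D i = Some \<tau> \<Longrightarrow> ctyping D \<Gamma> (Cst i) \<tau>"

inductive cstep :: "ctm \<Rightarrow> ctm \<Rightarrow> bool" where
  c_beta: "cstep (CApp (CLam \<sigma> t) u) (csubst t 0 u)"
| c_app: "cstep s s' \<Longrightarrow> cstep (CApp s t) (CApp s' t)"
| c_suc: "cstep (CApp CSuc (CNum n)) (CNum (Suc n))"
| c_suc_arg: "cstep t t' \<Longrightarrow> cstep (CApp CSuc t) (CApp CSuc t')"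
| c_pre: "cstep (CApp CPre (CNum n)) (CNum (n - 1))"
| c_pre_arg: "cstep t t' \<Longrightarrow> cstep (CApp CPre t) (CApp CPre t')"
| c_ifz0: "cstep (CApp (CApp (CApp CIfz (CNum 0)) p) q) p"
| c_ifzS: "cstep (CApp (CApp (CApp CIfz (CNum (Suc n))) p) q) q"
| c_ifz_arg: "cstep t t' \<Longrightarrow> cstep (CApp CIfz t) (CApp CIfz t')"
| c_Y: "cstep (CApp (CY \<sigma>) t) (CApp t (CApp (CY \<sigma>) t))"
| c_orc: "f n = Some v \<Longrightarrow> cstep (CApp (COrc f) (CNum n)) (CNum v)"
| c_orc_arg: "cstep t t' \<Longrightarrow> cstep (CApp (COrc f) t) (CApp (COrc f) t')"

fun inst :: "(nat \<Rightarrow> tm) \<Rightarrow> ctm \<Rightarrow> tm" where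
  "inst \<theta> (CVar i) = Var i"
| "inst \<theta> (CLam \<sigma> t) = Lam \<sigma> (inst \<theta> t)"
| "inst \<theta> (CApp s t) = App (inst \<theta> s) (inst \<theta> t)"
| "inst \<theta> (CNum n) = Num n"
| "inst \<theta> CSuc = SucC"
| "inst \<theta> CPre = PreC"
| "inst \<theta> CIfz = IfzC"
| "inst \<theta> (CY \<sigma>) = YC \<sigma>"
| "inst \<theta> (COrc f) = Orc f"
| "inst \<theta> (Cst i) = \<theta> i"

fun cinst :: "(nat \<Rightarrow> ctm) \<Rightarrow> ctm \<Rightarrow> ctm" where
  "cinst \<phi> (CLam \<sigma> t) = CLam \<sigma> (cinst \<phi> t)"
| "cinst \<phi> (CApp s t) = CApp (cinst \<phi> s) (cinst \<phi> t)"
| "cinst \<phi> (Cst i) = \<phi> i"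
| "cinst \<phi> c = c"

fun emb :: "tm \<Rightarrow> ctm" where
  "emb (Var i) = CVar i"
| "emb (Lam \<sigma> t) = CLam \<sigma> (emb t)"
| "emb (App s t) = CApp (emb s) (emb t)"
| "emb (Num n) = CNum n"
| "emb SucC = CSuc"
| "emb PreC = CPre"
| "emb IfzC = CIfz"
| "emb (YC \<sigma>) = CY \<sigma>"
| "emb (Orc f) = COrc f"

lemma inst_emb [simp]: "inst \<theta> (emb M) = M"
  by (induction M) auto

lemma inst_foldl: "inst \<theta> (foldl CApp a Ps) = foldl App (inst \<theta> a) (map (inst \<theta>) Ps)"
  by (induction Ps arbitrary: a) auto

lemma inst_cinst: "inst \<theta> (cinst \<phi> M) = inst (\<lambda>i. inst \<theta> (\<phi> i)) M"
  by (induction M) auto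

lemma ctyping_emb: "typing \<Gamma> M \<tau> \<Longrightarrow> ctyping D \<Gamma> (emb M) \<tau>"
  by (induction rule: typing.induct) (auto intro: ctyping.intros)

lemma ctyping_weaken: "ctyping D \<Gamma> M \<tau> \<Longrightarrow> ctyping D (\<Gamma> @ \<Delta>) M \<tau>"
proof (induction rule: ctyping.induct)
  case (C_Var i \<Gamma>)
  then show ?case using ctyping.C_Var[of i "\<Gamma> @ \<Delta>"] by (simp add: nth_append)
qed (auto intro: ctyping.intros)

lemma ctyping_foldl:
  "ctyping D \<Gamma> s (arrows \<sigma>s \<tau>) \<Longrightarrow> list_all2 (ctyping D \<Gamma>) ts \<sigma>s \<Longrightarrow> ctyping D \<Gamma> (foldl CApp s ts) \<tau>"
proof (induction ts arbitrary: s \<sigma>s)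
  case (Cons t ts)
  then obtain \<sigma> \<sigma>s' where "\<sigma>s = \<sigma> # \<sigma>s'" by (cases \<sigma>s) auto
  then show ?case using Cons by (auto simp: arrows_def intro: ctyping.C_App)
qed (simp add: arrows_def)

lemma ctyping_closed:
  "ctyping D \<Gamma> M \<tau> \<Longrightarrow> length \<Gamma> \<le> k \<Longrightarrow> clift k M = M \<and> csubst M k s = M"
  by (induction arbitrary: k s rule: ctyping.induct) auto

lemma ctyping_cinst:
  "ctyping D \<Gamma> M \<tau> \<Longrightarrow> (\<And>i \<sigma>. D i = Some \<sigma> \<Longrightarrow> ctyping D' [] (\<phi> i) \<sigma>) \<Longrightarrow>
    ctyping D' \<Gamma> (cinst \<phi> M) \<tau>"
proof (induction rule: ctyping.induct)
  case (C_Cst i \<tau> \<Gamma>)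
  then show ?case using ctyping_weaken[of D' "[]" _ _ \<Gamma>] by simp
qed (auto intro: ctyping.intros)

lemma typing_inst:
  "ctyping D \<Gamma> M \<tau> \<Longrightarrow> (\<And>i \<sigma>. D i = Some \<sigma> \<Longrightarrow> typing [] (\<theta> i) \<sigma>) \<Longrightarrow>
    typing \<Gamma> (inst \<theta> M) \<tau>"
proof (induction rule: ctyping.induct)
  case (C_Cst i \<tau> \<Gamma>)
  then show ?case using typing_weaken[of "[]" _ _ \<Gamma>] by simp
qed (auto intro: typing.intros)

lemma inst_cong:
  "ctyping D \<Gamma> M \<tau> \<Longrightarrow> (\<And>i \<sigma>. D i = Some \<sigma> \<Longrightarrow> \<theta> i = \<theta>' i) \<Longrightarrow> inst \<theta> M = inst \<theta>' M"
  by (induction rule: ctyping.induct) auto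

inductive_cases ctyping_VarE: "ctyping D \<Gamma> (CVar i) \<tau>"
inductive_cases ctyping_LamE: "ctyping D \<Gamma> (CLam \<sigma> b) \<tau>"
inductive_cases ctyping_AppE: "ctyping D \<Gamma> (CApp s t) \<tau>"
inductive_cases ctyping_constE: "ctyping D \<Gamma> (CNum n) \<tau>" "ctyping D \<Gamma> CSuc \<tau>" "ctyping D \<Gamma> CPre \<tau>"
  "ctyping D \<Gamma> CIfz \<tau>" "ctyping D \<Gamma> (CY \<sigma>) \<tau>" "ctyping D \<Gamma> (COrc f) \<tau>" "ctyping D \<Gamma> (Cst i) \<tau>"

lemmas ctyping_elims = ctyping_VarE ctyping_LamE ctyping_AppE ctyping_constE

lemma ctyping_unique: "ctyping D \<Gamma> M \<tau> \<Longrightarrow> ctyping D \<Gamma> M \<tau>' \<Longrightarrow> \<tau> = \<tau>'"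
proof (induction arbitrary: \<tau>' rule: ctyping.induct)
  case (C_App \<Gamma> s \<sigma> \<tau> t)
  from C_App.prems obtain \<sigma>' where "ctyping D \<Gamma> s (TFun \<sigma>' \<tau>')" by (rule ctyping_AppE)
  from C_App.IH(1)[OF this] show ?case by simp
next
  case (C_Lam \<sigma> \<Gamma> t \<tau>)
  from C_Lam.prems obtain \<tau>2 where "\<tau>' = TFun \<sigma> \<tau>2" "ctyping D (\<sigma> # \<Gamma>) t \<tau>2" by (rule ctyping_LamE)
  with C_Lam.IH show ?case by blast
qed (auto elim: ctyping_elims)

section \<open>Symbolic evaluation up to the call of a constant\<close>

definition closed_env :: "(nat \<Rightarrow> tm) \<Rightarrow> bool" where
  "closed_env \<theta> \<longleftrightarrow> (\<forall>i. closed (\<theta> i))"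

lemma inst_clift: "closed_env \<theta> \<Longrightarrow> inst \<theta> (clift k M) = lift k (inst \<theta> M)"
  by (induction M arbitrary: k) (auto simp: closed_env_def closedD)

text \<open>The supplied terms are closed, hence fixed by lifting and substitution.\<close>

lemma inst_csubst: "closed_env \<theta> \<Longrightarrow> inst \<theta> (csubst M k u) = subst (inst \<theta> M) k (inst \<theta> u)"
  by (induction M arbitrary: k u) (auto simp: inst_clift, auto simp: closed_env_def closedD)

lemma cstep_inst: "cstep M N \<Longrightarrow> closed_env \<theta> \<Longrightarrow> step (inst \<theta> M) (inst \<theta> N)"
  by (induction rule: cstep.induct) (auto simp: inst_csubst intro: step.intros step.s_pre[simplified One_nat_def])

lemma csteps_inst: "cstep\<^sup>*\<^sup>* M N \<Longrightarrow> closed_env \<theta> \<Longrightarrow> step\<^sup>*\<^sup>* (inst \<theta> M) (inst \<theta> N)"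
  by (induction rule: rtranclp_induct) (auto intro: rtranclp.rtrancl_into_rtrancl cstep_inst)

lemma sim_inst: "(\<And>i. sim (\<theta> i) (\<theta>' i)) \<Longrightarrow> sim (inst \<theta> M) (inst \<theta>' M)"
  by (induction M) (auto intro: sim.intros)

definition cstrict :: "ctm \<Rightarrow> bool" where
  "cstrict f \<longleftrightarrow> f = CSuc \<or> f = CPre \<or> f = CIfz \<or> (\<exists>g. f = COrc g)"

text \<open>\<open>Cst j\<close> occupies the evaluation position, so symbolic evaluation cannot go
  on before this constant is known.\<close>

inductive stuck :: "nat \<Rightarrow> ctm \<Rightarrow> bool" for j where
  st_Cst: "stuck j (Cst j)"
| st_head: "stuck j M \<Longrightarrow> stuck j (CApp M N)"
| st_arg: "stuck j M \<Longrightarrow> cstrict f \<Longrightarrow> stuck j (CApp f M)"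

lemma inst_strict: "cstrict f \<Longrightarrow> strict (inst \<theta> f)"
  by (auto simp: cstrict_def strict_def)

lemma stuck_inst: "stuck j M \<Longrightarrow> in_eval_pos (\<theta> j) (inst \<theta> M)"
  by (induction rule: stuck.induct) (auto intro: in_eval_pos.intros inst_strict)

lemma inst_eq_cases:
  "inst \<theta> M = Lam \<sigma> b \<Longrightarrow> (\<exists>j. M = Cst j) \<or> (\<exists>b'. M = CLam \<sigma> b' \<and> b = inst \<theta> b')"
  "inst \<theta> M = App s t \<Longrightarrow> (\<exists>j. M = Cst j) \<or> (\<exists>s' t'. M = CApp s' t' \<and> s = inst \<theta> s' \<and> t = inst \<theta> t')"
  "inst \<theta> M = Num n \<Longrightarrow> (\<exists>j. M = Cst j) \<or> M = CNum n"
  "inst \<theta> M = SucC \<Longrightarrow> (\<exists>j. M = Cst j) \<or> M = CSuc"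
  "inst \<theta> M = PreC \<Longrightarrow> (\<exists>j. M = Cst j) \<or> M = CPre"
  "inst \<theta> M = IfzC \<Longrightarrow> (\<exists>j. M = Cst j) \<or> M = CIfz"
  "inst \<theta> M = YC \<sigma> \<Longrightarrow> (\<exists>j. M = Cst j) \<or> M = CY \<sigma>"
  "inst \<theta> M = Orc f \<Longrightarrow> (\<exists>j. M = Cst j) \<or> M = COrc f"
  by (cases M; auto)+

lemma inst_ifz:
  assumes "inst \<theta> M = App (App IfzC (Num n)) p"
  shows "(\<exists>j. stuck j M) \<or> (\<exists>p'. M = CApp (CApp CIfz (CNum n)) p' \<and> p = inst \<theta> p')"
proof -
  consider j where "M = Cst j" | u p' where "M = CApp u p'" "p = inst \<theta> p'" "inst \<theta> u = App IfzC (Num n)"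
    using inst_eq_cases(2)[OF assms] by metis
  then show ?thesis
  proof cases
    case 2
    consider j where "u = Cst j" | i m where "u = CApp i m" "inst \<theta> i = IfzC" "inst \<theta> m = Num n"
      using inst_eq_cases(2)[OF 2(3)] by metis
    then show ?thesis
    proof cases
      case 2
      have "stuck j (CApp (CApp CIfz (Cst j)) p')" for j
        by (intro st_head st_arg st_Cst) (simp add: cstrict_def)
      moreover have "stuck j (CApp (CApp (Cst j) u) p')" for j u
        by (intro st_head st_Cst)
      ultimately show ?thesis
        using 2 inst_eq_cases(6)[of \<theta> i] inst_eq_cases(3)[of \<theta> m n] \<open>M = CApp u p'\<close> \<open>p = inst \<theta> p'\<close>
        by auto
    qed (use 2 in \<open>blast intro: stuck.intros\<close>)
  qed (blast intro: stuck.intros)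
qed

text \<open>Instantiation can create a new redex in evaluation position only where a constant is
  found there. Any other redex is already visible in \<open>M\<close>, and its contraction does not
  depend on \<theta>.\<close>

lemma step_inst_cases:
  "closed_env \<theta> \<Longrightarrow> step (inst \<theta> M) N \<Longrightarrow> (\<exists>M'. cstep M M' \<and> N = inst \<theta> M') \<or> (\<exists>j. stuck j M)"
proof (induction M arbitrary: N)
  case (CApp M1 M2)
  have stuck1: "\<exists>j. stuck j (CApp M1 M2)" if "M1 = Cst j \<or> stuck j M1" for j
    using that by (auto intro: stuck.intros)
  have stuck2: "\<exists>j. stuck j (CApp M1 M2)" if "M2 = Cst j \<or> stuck j M2" "cstrict M1" for j
    using that by (auto intro: stuck.intros)
  from CApp.prems(2) have "step (App (inst \<theta> M1) (inst \<theta> M2)) N" by simp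
  then show ?case
  proof (cases rule: step.cases)
    case (s_beta \<sigma> t)
    then show ?thesis
      using stuck1 CApp.prems(1) inst_eq_cases(1)[of \<theta> M1]
      by (metis c_beta inst_csubst)
  next
    case (s_app s')
    then show ?thesis
      using CApp.IH(1)[OF CApp.prems(1)] stuck1 c_app by (metis inst.simps(3))
  next
    case (s_suc n)
    then show ?thesis
      using inst_eq_cases(4)[of \<theta> M1] inst_eq_cases(3)[of \<theta> M2] stuck1 stuck2 c_suc
      unfolding cstrict_def by (metis inst.simps(4))
  next
    case (s_suc_arg t')
    then show ?thesis
      using inst_eq_cases(4)[of \<theta> M1] CApp.IH(2)[OF CApp.prems(1)] stuck1 stuck2 c_suc_arg
      unfolding cstrict_def by (metis inst.simps(3))
  next
    case (s_pre n)
    then show ?thesis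
      using inst_eq_cases(5)[of \<theta> M1] inst_eq_cases(3)[of \<theta> M2] stuck1 stuck2 c_pre
      unfolding cstrict_def by (metis inst.simps(4))
  next
    case (s_pre_arg t')
    then show ?thesis
      using inst_eq_cases(5)[of \<theta> M1] CApp.IH(2)[OF CApp.prems(1)] stuck1 stuck2 c_pre_arg
      unfolding cstrict_def by (metis inst.simps(3))
  next
    case s_ifz0
    then show ?thesis
      using inst_ifz[of \<theta> M1 0 N] stuck1 c_ifz0 by metis
  next
    case (s_ifzS n p)
    then show ?thesis
      using inst_ifz[of \<theta> M1 "Suc n" p] stuck1 c_ifzS by metis
  next
    case (s_ifz_arg t')
    then show ?thesis
      using inst_eq_cases(6)[of \<theta> M1] CApp.IH(2)[OF CApp.prems(1)] stuck1 stuck2 c_ifz_arg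
      unfolding cstrict_def by (metis inst.simps(3))
  next
    case (s_Y \<sigma>)
    then show ?thesis
      using inst_eq_cases(7)[of \<theta> M1] stuck1 c_Y by (metis inst.simps(3))
  next
    case (s_orc f n v)
    then show ?thesis
      using inst_eq_cases(8)[of \<theta> M1] inst_eq_cases(3)[of \<theta> M2] stuck1 stuck2 c_orc
      unfolding cstrict_def by (metis inst.simps(4))
  next
    case (s_orc_arg t' f)
    then show ?thesis
      using inst_eq_cases(8)[of \<theta> M1] CApp.IH(2)[OF CApp.prems(1)] stuck1 stuck2 c_orc_arg
      unfolding cstrict_def by (metis inst.simps(3))
  qed
qed (auto intro: stuck.intros)

text \<open>The steps to \<open>M'\<close> are symbolic, so by \<open>csteps_inst\<close> a single
  evaluating instance determines a term through which all closed instances pass.\<close>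

lemma evals_inst_cases:
  assumes "closed_env \<theta>" "evals (inst \<theta> M) n"
  shows "\<exists>M'. cstep\<^sup>*\<^sup>* M M' \<and> (M' = CNum n \<or> (\<exists>j. stuck j M'))"
proof -
  from assms(2) have "step\<^sup>*\<^sup>* (inst \<theta> M) (Num n)" by (simp add: evals_def)
  then show ?thesis
  proof (induction "inst \<theta> M" arbitrary: M rule: converse_rtranclp_induct)
    case base
    then show ?case using inst_eq_cases(3)[of \<theta> M n] st_Cst by (metis rtranclp.rtrancl_refl)
  next
    case (step N)
    then show ?case
      using step_inst_cases[OF assms(1), of M N] by (metis converse_rtranclp_into_rtranclp rtranclp.rtrancl_refl)
  qed
qed

text \<open>In \<open>call j Ps M\<close> the list \<open>Ps\<close> may be a proper prefix of the arguments of the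
  stuck constant; \<open>stuck_full\<close> selects the complete one.\<close>
inductive call :: "nat \<Rightarrow> ctm list \<Rightarrow> ctm \<Rightarrow> bool" for j Ps where
  ca_here: "call j Ps (foldl CApp (Cst j) Ps)"
| ca_head: "call j Ps M \<Longrightarrow> call j Ps (CApp M N)"
| ca_arg: "call j Ps M \<Longrightarrow> cstrict f \<Longrightarrow> call j Ps (CApp f M)"

lemma call_inst: "call j Ps M \<Longrightarrow> in_eval_pos (foldl App (\<theta> j) (map (inst \<theta>) Ps)) (inst \<theta> M)"
proof (induction rule: call.induct)
  case ca_here
  show ?case by (simp add: in_eval_pos.here inst_foldl)
qed (auto intro: in_eval_pos.intros inst_strict)

text \<open>Arguments are collected outwards from the constant. While some are missing, the term is
  a bare spine whose type still lists them; such a spine has a function type and cannot be the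
  argument of a strict constant.\<close>

lemma stuck_full:
  assumes "D j = Some (arrows \<sigma>s TN)"
  shows "stuck j M \<Longrightarrow> ctyping D [] M \<tau> \<Longrightarrow>
    (\<exists>Ps. length Ps = length \<sigma>s \<and> call j Ps M) \<or>
    (\<exists>Ps. M = foldl CApp (Cst j) Ps \<and> length Ps < length \<sigma>s \<and> \<tau> = arrows (drop (length Ps) \<sigma>s) TN)"
proof (induction arbitrary: \<tau> rule: stuck.induct)
  case st_Cst
  then have "\<tau> = arrows \<sigma>s TN" using assms by (auto elim: ctyping_elims)
  then show ?case
    using ca_here[of j "[]"] by (cases "\<sigma>s = []") (auto intro!: exI[of _ "[]"])
next
  case (st_head M N)
  then obtain \<sigma> where "ctyping D [] M (TFun \<sigma> \<tau>)" by (blast elim: ctyping_AppE)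
  from st_head.IH[OF this] show ?case
  proof (elim disjE exE conjE)
    fix Ps assume Ps: "M = foldl CApp (Cst j) Ps" "length Ps < length \<sigma>s"
      "TFun \<sigma> \<tau> = arrows (drop (length Ps) \<sigma>s) TN"
    then have \<tau>: "\<tau> = arrows (drop (length (Ps @ [N])) \<sigma>s) TN"
      by (simp add: arrows_def Cons_nth_drop_Suc[symmetric])
    show ?case
    proof (cases "length (Ps @ [N]) = length \<sigma>s")
      case True
      then show ?thesis using ca_here[of j "Ps @ [N]"] Ps by (intro disjI1 exI[of _ "Ps @ [N]"]) simp
    next
      case False
      then show ?thesis using \<tau> Ps by (intro disjI2 exI[of _ "Ps @ [N]"]) simp
    qed
  qed (blast intro: ca_head)
next
  case (st_arg M f)
  then have "ctyping D [] M TN" by (auto elim!: ctyping_elims simp: cstrict_def)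
  from st_arg.IH[OF this] show ?case
  proof (elim disjE exE conjE)
    fix Ps assume "length Ps < length \<sigma>s" "TN = arrows (drop (length Ps) \<sigma>s) TN"
    then show ?case by (simp add: arrows_def Cons_nth_drop_Suc[symmetric])
  qed (use st_arg.hyps in \<open>blast intro: ca_arg\<close>)
qed

lemma stuck_typed: "stuck j M \<Longrightarrow> ctyping D \<Gamma> M \<tau> \<Longrightarrow> D j \<noteq> None"
  by (induction arbitrary: \<tau> rule: stuck.induct) (auto elim!: ctyping_elims)

lemma spine_not_strict: "\<not> cstrict (foldl CApp (Cst j) Ps)"
  by (cases Ps rule: rev_cases) (auto simp: cstrict_def)

lemma call_not_strict: "call j Ps M \<Longrightarrow> \<not> cstrict M"
  by (induction rule: call.induct) (auto simp: spine_not_strict, auto simp: cstrict_def)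

definition list_env :: "ty list \<Rightarrow> nat \<Rightarrow> ty option" where
  "list_env \<tau>s i = (if i < length \<tau>s then Some (\<tau>s ! i) else None)"

section \<open>Colouring the evaluation\<close>

text \<open>\<open>S\<close> holds the foreign subterms available to code of colour
  \<open>Some S\<close>, and each argument still awaited may add one. At \<open>m = 0\<close> the
  total is kept at most \<open>l\<close>, which is what the chain argument at level 1
  contradicts.\<close>

definition box_count :: "nat \<Rightarrow> nat \<Rightarrow> ctm set \<Rightarrow> ty \<Rightarrow> bool" where
  "box_count m l S \<tau> \<longleftrightarrow> finite S \<and> (m = 0 \<longrightarrow> card S + length (args \<tau>) \<le> l)"

text \<open>The condition holds for all types of sublevel at most \<open>(m + 1, l)\<close> and is
  inherited by the types of partial applications.\<close>

definition inner_ok :: "nat \<Rightarrow> nat \<Rightarrow> ty \<Rightarrow> bool" where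
  "inner_ok m l \<tau> \<longleftrightarrow> (\<forall>\<sigma> \<in> set (args \<tau>). sublevel_le \<sigma> m l)"

lemma args_arrows: "args (arrows \<sigma>s \<tau>) = \<sigma>s @ args \<tau>"
  by (induction \<sigma>s) (auto simp: arrows_def)

lemma lv_args: "\<sigma> \<in> set (args \<tau>) \<Longrightarrow> lv \<sigma> < lv \<tau> \<and> width \<sigma> \<le> width \<tau>"
  by (induction \<tau>) auto

lemma lv_0: "lv \<tau> = 0 \<Longrightarrow> \<tau> = TN"
  by (cases \<tau>) auto

lemma length_args_le_width: "length (args \<sigma>) \<le> width \<sigma>"
  by (cases \<sigma>) auto

section \<open>The two-coloured typing\<close>

locale factoring =
  fixes m l :: nat
begin

abbreviation "arg_ty \<equiv> rho m (Suc l)"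
definition fun_ty :: ty where "fun_ty = arrows (replicate (Suc l) arg_ty) TN"

definition base_env :: "nat \<Rightarrow> ty option" where
  "base_env i = (if i = 0 then Some fun_ty else if i \<le> Suc l then Some arg_ty else None)"

text \<open>
  A two-colouring of the program \<open>r (t\<^sub>0 X) \<dots> (t\<^sub>n X) Z\<^sub>0 \<dots> Z\<^sub>l\<close>, where \<open>X\<close> is
  \<open>Cst 0\<close> and \<open>Z\<^sub>i\<close> is \<open>Cst (Suc i)\<close>. Colour \<open>None\<close> marks code of \<open>r\<close>, which may
  mention the \<open>Z\<^sub>i\<close>; colour \<open>Some S\<close> marks code of some \<open>t\<^sub>i X\<close>, which may mention \<open>X\<close>.
  Subterms of the other colour (\<open>col_inner\<close>, \<open>col_outer\<close>) contain no bound variables and are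
  of restricted type, and in colour \<open>Some S\<close> they belong to \<open>S\<close>. The flag \<open>True\<close> exempts the
  subterm in evaluation position from membership in \<open>S\<close>: this subterm changes during
  evaluation, while its copies elsewhere do not.\<close>
inductive col :: "bool \<Rightarrow> ctm set option \<Rightarrow> ty list \<Rightarrow> ctm \<Rightarrow> ty \<Rightarrow> bool" where
  col_Var: "i < length \<Gamma> \<Longrightarrow> col e c \<Gamma> (CVar i) (\<Gamma> ! i)"
| col_Lam: "col False c (\<sigma> # \<Gamma>) t \<tau> \<Longrightarrow> col e c \<Gamma> (CLam \<sigma> t) (TFun \<sigma> \<tau>)"
| col_App: "col e c \<Gamma> s (TFun \<sigma> \<tau>) \<Longrightarrow> col False c \<Gamma> t \<sigma> \<Longrightarrow> col e c \<Gamma> (CApp s t) \<tau>"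
| col_strict: "cstrict f \<Longrightarrow> ctyping base_env [] f (TFun TN \<tau>) \<Longrightarrow> col True c \<Gamma> t TN \<Longrightarrow>
    col True c \<Gamma> (CApp f t) \<tau>"
| col_Num: "col e c \<Gamma> (CNum n) TN"
| col_Suc: "col e c \<Gamma> CSuc (TFun TN TN)"
| col_Pre: "col e c \<Gamma> CPre (TFun TN TN)"
| col_Ifz: "col e c \<Gamma> CIfz (TFun TN (TFun TN (TFun TN TN)))"
| col_Y: "col e c \<Gamma> (CY \<sigma>) (TFun (TFun \<sigma> \<sigma>) \<sigma>)"
| col_Orc: "col e c \<Gamma> (COrc f) (TFun TN TN)"
| col_fun: "col e (Some S) \<Gamma> (Cst 0) fun_ty"
| col_arg: "i \<le> l \<Longrightarrow> col e None \<Gamma> (Cst (Suc i)) arg_ty"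
| col_inner: "col e (Some S) [] M \<tau> \<Longrightarrow> inner_ok m l \<tau> \<Longrightarrow> box_count m l S \<tau> \<Longrightarrow> col e None \<Gamma> M \<tau>"
| col_outer: "col e None [] M \<tau> \<Longrightarrow> sublevel_le \<tau> m l \<Longrightarrow> \<not> e \<longrightarrow> M \<in> S \<Longrightarrow> col e (Some S) \<Gamma> M \<tau>"

lemma col_ctyping: "col e c \<Gamma> M \<tau> \<Longrightarrow> ctyping base_env \<Gamma> M \<tau>"
proof (induction rule: col.induct)
  case (col_strict f \<tau> c \<Gamma> t)
  then show ?case using ctyping_weaken[of base_env "[]" f _ \<Gamma>] by (auto intro: ctyping.C_App)
next
  case (col_inner e S M \<tau> \<Gamma>)
  then show ?case using ctyping_weaken[of base_env "[]" M _ \<Gamma>] by simp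
next
  case (col_outer e M \<tau> S \<Gamma>)
  then show ?case using ctyping_weaken[of base_env "[]" M _ \<Gamma>] by simp
qed (auto intro: ctyping.intros simp: base_env_def)

lemma col_weaken: "col e c \<Gamma> M \<tau> \<Longrightarrow> col e c (\<Gamma> @ \<Delta>) M \<tau>"
proof (induction rule: col.induct)
  case (col_Var i \<Gamma> e c)
  then show ?case using col.col_Var[of i "\<Gamma> @ \<Delta>"] by (simp add: nth_append)
qed (auto intro: col.intros)

lemma col_promote: "col e c \<Gamma> M \<tau> \<Longrightarrow> col True c \<Gamma> M \<tau>"
  by (induction rule: col.induct) (auto intro: col.intros)

text \<open>Subterms of the other colour are typed in the empty context, so substitution changes
  neither them nor their membership in \<open>S\<close>.\<close>

lemma col_subst:
  "col e c \<Gamma>' M \<tau> \<Longrightarrow> \<not> e \<Longrightarrow> \<Gamma>' = \<Gamma> @ [\<sigma>] \<Longrightarrow> col False c [] u \<sigma> \<Longrightarrow>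
    col False c \<Gamma> (csubst M (length \<Gamma>) u) \<tau>"
proof (induction arbitrary: \<Gamma> rule: col.induct)
  case (col_Var i \<Gamma>' e c)
  show ?case
  proof (cases "i < length \<Gamma>")
    case True
    then show ?thesis using col_Var col.col_Var[of i \<Gamma>] by (simp add: nth_append)
  next
    case False
    then have "i = length \<Gamma>" using col_Var by simp
    then show ?thesis using col_Var col_weaken[of False c "[]" u \<sigma> \<Gamma>] by simp
  qed
next
  case (col_Lam c \<sigma>' \<Gamma>' t \<tau>)
  then show ?case
    using col_Lam.IH[of "\<sigma>' # \<Gamma>"] ctyping_closed[OF col_ctyping[OF col_Lam.prems(3)], of 0]
    by (auto intro!: col.col_Lam)
next
  case (col_inner e S M \<tau> \<Gamma>')
  then show ?case
    using ctyping_closed[OF col_ctyping[OF col_inner.hyps(1)], of "length \<Gamma>"]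
    by (auto intro: col.col_inner)
next
  case (col_outer e M \<tau> S \<Gamma>')
  then show ?case
    using ctyping_closed[OF col_ctyping[OF col_outer.hyps(1)], of "length \<Gamma>"]
    by (auto intro: col.col_outer)
qed (auto intro: col.intros)

section \<open>Moving arguments through changes of colour\<close>

fun col_le :: "ctm set option \<Rightarrow> ctm set option \<Rightarrow> bool" where
  "col_le None c \<longleftrightarrow> c = None"
| "col_le (Some S) c \<longleftrightarrow> (\<exists>S'. c = Some S' \<and> S \<subseteq> S')"

text \<open>For \<open>Some S\<close> this is the bound of \<open>box_count\<close> when no argument
  is awaited any more.\<close>

fun col_fin :: "ctm set option \<Rightarrow> bool" where
  "col_fin None \<longleftrightarrow> True"
| "col_fin (Some S) \<longleftrightarrow> finite S \<and> (m = 0 \<longrightarrow> card S \<le> l)"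

lemma col_mono: "col e c \<Gamma> M \<tau> \<Longrightarrow> col_le c c' \<Longrightarrow> col e c' \<Gamma> M \<tau>"
  by (induction arbitrary: c' rule: col.induct) (auto intro: col.intros)

text \<open>The last rule in a derivation of \<open>col True c [] M \<upsilon>\<close> is not a change of colour.\<close>
definition core :: "ctm set option \<Rightarrow> ctm \<Rightarrow> ty \<Rightarrow> bool" where
  "core c M \<upsilon> \<longleftrightarrow> (case M of
      CLam \<sigma> b \<Rightarrow> \<exists>\<tau>. \<upsilon> = TFun \<sigma> \<tau> \<and> col False c [\<sigma>] b \<tau>
    | CApp s t \<Rightarrow> (\<exists>\<sigma>. col True c [] s (TFun \<sigma> \<upsilon>) \<and> col False c [] t \<sigma>) \<or> (cstrict s \<and> col True c [] t TN)
    | Cst i \<Rightarrow> i = 0 \<longrightarrow> c \<noteq> None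
    | _ \<Rightarrow> True)"

lemma core_mono:
  assumes "core c M \<upsilon>" "col_le c c'"
  shows "core c' M \<upsilon>"
proof -
  have mono: "col e c \<Gamma> N \<tau> \<Longrightarrow> col e c' \<Gamma> N \<tau>" for e \<Gamma> N \<tau>
    using col_mono assms(2) by blast
  have "c \<noteq> None \<Longrightarrow> c' \<noteq> None" using assms(2) by (cases c) auto
  then show ?thesis
    using assms(1) mono unfolding core_def by (cases M) (simp_all, blast+)
qed

lemma sublevel_arrows: "sublevel_le (arrows \<sigma>s \<tau>) m l \<Longrightarrow> sublevel_le \<tau> m l"
proof (induction \<sigma>s)
  case (Cons \<sigma> \<sigma>s)
  then show ?case by (intro Cons.IH) (auto simp: sublevel_le_def arrows_def)
qed (simp add: arrows_def)

text \<open>Argument types have level below \<open>m\<close>, so \<open>m\<close> is positive and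
  \<open>box_count\<close> amounts to finiteness. This lets code of colour \<open>Some S\<close>
  pass arguments to foreign functions.\<close>

lemma sublevel_args: "sublevel_le \<tau> m l \<Longrightarrow> \<sigma> \<in> set (args \<tau>) \<Longrightarrow> inner_ok m l \<sigma> \<and> m > 0"
  unfolding inner_ok_def sublevel_le_def
  by (metis args.simps(1) empty_iff empty_set gr_zeroI less_imp_not_less less_trans lv_args not_less_zero)

lemma inner_ok_arrows:
  "inner_ok m l (arrows \<sigma>s \<tau>) \<longleftrightarrow> (\<forall>\<sigma> \<in> set \<sigma>s. sublevel_le \<sigma> m l) \<and> inner_ok m l \<tau>"
  by (auto simp: inner_ok_def args_arrows)

text \<open>Each argument supplied adds at most one element to \<open>S\<close> and lowers the arity
  by one, so the bounded sum does not grow.\<close>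

lemma box_count_arrows:
  assumes "box_count m l S (arrows \<sigma>s \<tau>)" "length ts = length \<sigma>s"
  shows "box_count m l (S \<union> set ts) \<tau>" "col_fin (Some (S \<union> set ts))"
proof -
  have "card (S \<union> set ts) \<le> card S + length \<sigma>s"
    using card_Un_le[of S "set ts"] card_length[of ts] assms(2) by linarith
  then show "box_count m l (S \<union> set ts) \<tau>" "col_fin (Some (S \<union> set ts))"
    using assms by (auto simp: box_count_def args_arrows)
qed

text \<open>Pending arguments \<open>ts\<close> are pushed through each change of colour around \<open>M\<close>. At such a
  change from \<open>None\<close> to \<open>Some S\<close> they join \<open>S\<close>, which is paid for by the arity in
  \<open>box_count\<close>.\<close>
lemma unbox:
  "col e c \<Gamma> M \<upsilon> \<Longrightarrow> e \<Longrightarrow> \<Gamma> = [] \<Longrightarrow> \<upsilon> = arrows \<sigma>s \<tau> \<Longrightarrow> col_le c c' \<Longrightarrow> col_fin c' \<Longrightarrow>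
   list_all2 (col False c' []) ts \<sigma>s \<Longrightarrow>
   \<exists>c''. core c'' M \<upsilon> \<and> col_fin c'' \<and> list_all2 (col False c'' []) ts \<sigma>s \<and>
     (\<forall>N. col True c'' [] N \<tau> \<longrightarrow> col True c' [] N \<tau>)"
proof (induction arbitrary: c' rule: col.induct)
  case (col_inner e S M \<upsilon> \<Gamma>)
  have [simp]: "c' = None" using col_inner.prems by simp
  have len: "length ts = length \<sigma>s" using col_inner.prems(6) by (simp add: list_all2_lengthD)
  have bc: "box_count m l (S \<union> set ts) \<tau>" "col_fin (Some (S \<union> set ts))"
    using box_count_arrows[OF _ len, of S \<tau>] col_inner by auto
  have ok: "\<forall>\<sigma> \<in> set \<sigma>s. sublevel_le \<sigma> m l" "inner_ok m l \<tau>"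
    using col_inner by (auto simp: inner_ok_arrows)
  have "list_all2 (col False (Some (S \<union> set ts)) []) ts \<sigma>s"
    using col_inner.prems(6) ok(1) by (auto simp: list_all2_conv_all_nth intro!: col.col_outer)
  then obtain c'' where "core c'' M \<upsilon>" "col_fin c''" "list_all2 (col False c'' []) ts \<sigma>s"
     "\<forall>N. col True c'' [] N \<tau> \<longrightarrow> col True (Some (S \<union> set ts)) [] N \<tau>"
    using col_inner.IH[of "Some (S \<union> set ts)"] col_inner.prems bc by auto
  then show ?case using col.col_inner[OF _ ok(2) bc(1)] by auto
next
  case (col_outer e M \<upsilon> S \<Gamma>)
  then obtain S' where [simp]: "c' = Some S'" by auto
  \<comment> \<open>An argument passed to a foreign function is itself boxed by
    \<open>col_inner\<close>, with the current set \<open>S'\<close>.\<close>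
  have "col False None [] t \<sigma>" if "col False (Some S') [] t \<sigma>" "\<sigma> \<in> set \<sigma>s" for t \<sigma>
  proof -
    have "\<sigma> \<in> set (args \<upsilon>)" using that col_outer.prems by (simp add: args_arrows)
    from sublevel_args[OF col_outer.hyps(2) this] show ?thesis
      using that col_outer.prems(5) by (intro col.col_inner[OF that(1)]) (auto simp: box_count_def)
  qed
  then have "list_all2 (col False None []) ts \<sigma>s"
    using col_outer.prems(6) by (auto simp: list_all2_conv_all_nth)
  then obtain c'' where "core c'' M \<upsilon>" "col_fin c''" "list_all2 (col False c'' []) ts \<sigma>s"
     "\<forall>N. col True c'' [] N \<tau> \<longrightarrow> col True None [] N \<tau>"
    using col_outer.IH[of None] col_outer.prems by auto
  moreover have "sublevel_le \<tau> m l" using sublevel_arrows col_outer by blast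
  ultimately show ?case using col.col_outer[of True] by auto
next
  case (col_Lam c \<sigma> \<Gamma> t \<tau>' e)
  from col_Lam.hyps col_Lam.prems(2) have "core c (CLam \<sigma> t) (TFun \<sigma> \<tau>')" by (simp add: core_def)
  then show ?case using col_Lam core_mono by blast
next
  case (col_App e c \<Gamma> s \<sigma> \<tau>' t)
  then have "core c (CApp s t) \<tau>'" by (auto simp add: core_def)
  then show ?case using col_App core_mono by blast
next
  case (col_strict f \<tau>' c \<Gamma> t)
  then have "core c (CApp f t) \<tau>'" by (auto simp add: core_def)
  then show ?case using col_strict core_mono by blast
next
  case (col_arg i e \<Gamma>)
  then show ?case by (intro exI[of _ None]) (auto simp: core_def)
qed (auto simp: core_def)

text \<open>Without pending arguments, \<open>unbox\<close> finds the colour \<open>c'\<close> of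
  the code in which the application is written; results of colour \<open>c'\<close> are returned
  through the changes of colour to \<open>c\<close>.\<close>

lemma unbox_App:
  assumes "col True c [] (CApp s t) \<tau>" "col_fin c"
  obtains c' \<sigma> where "col_fin c'" "\<And>N. col True c' [] N \<tau> \<Longrightarrow> col True c [] N \<tau>"
    "ctyping base_env [] s (TFun \<sigma> \<tau>)"
    "(col True c' [] s (TFun \<sigma> \<tau>) \<and> col False c' [] t \<sigma>) \<or> (cstrict s \<and> col True c' [] t TN)"
proof -
  have "col_le c c" by (cases c) auto
  then obtain c' where c': "core c' (CApp s t) \<tau>" "col_fin c'" "\<forall>N. col True c' [] N \<tau> \<longrightarrow> col True c [] N \<tau>"
    using unbox[OF assms(1), of "[]" \<tau> c "[]"] assms(2) by (auto simp: arrows_def)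
  from col_ctyping[OF assms(1)] obtain \<sigma> where ty: "ctyping base_env [] s (TFun \<sigma> \<tau>)" by (rule ctyping_AppE)
  from c'(1) ty have "(col True c' [] s (TFun \<sigma> \<tau>) \<and> col False c' [] t \<sigma>) \<or> (cstrict s \<and> col True c' [] t TN)"
    unfolding core_def using ctyping_unique[OF col_ctyping ty] by fastforce
  then show ?thesis using that c' ty by blast
qed

text \<open>The function may be written in another colour than the application. Keeping the argument
  pending while the function is unboxed gives both a common colour.\<close>

lemma unbox_head:
  assumes "col True c [] s (TFun \<sigma> \<tau>)" "col False c [] t \<sigma>" "col_fin c"
  obtains c' where "col_fin c'" "core c' s (TFun \<sigma> \<tau>)" "col False c' [] t \<sigma>"
    "\<And>N. col True c' [] N \<tau> \<Longrightarrow> col True c [] N \<tau>"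
proof -
  have "col_le c c" by (cases c) auto
  then show ?thesis
    using unbox[OF assms(1), of "[\<sigma>]" \<tau> c "[t]"] assms that by (auto simp: arrows_def)
qed

section \<open>Preservation of colours under reduction\<close>

inductive_cases cstep_constE: "cstep CSuc N" "cstep CPre N" "cstep CIfz N" "cstep (COrc f) N"

text \<open>The argument is in evaluation position, so it carries flag \<open>True\<close> and may
  be replaced by a reduct outside \<open>S\<close>.\<close>

lemma col_strict_arg:
  assumes "cstrict f" "col True c [] (CApp f t) \<tau>" "col_fin c"
    "\<And>c. col True c [] t TN \<Longrightarrow> col_fin c \<Longrightarrow> col True c [] t' TN"
  shows "col True c [] (CApp f t') \<tau>"
  using assms(2,3)
proof (rule unbox_App)
  fix c' \<sigma> assume c': "col_fin c'" "\<And>N. col True c' [] N \<tau> \<Longrightarrow> col True c [] N \<tau>"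
    and ty: "ctyping base_env [] f (TFun \<sigma> \<tau>)"
    and 1: "col True c' [] f (TFun \<sigma> \<tau>) \<and> col False c' [] t \<sigma> \<or> cstrict f \<and> col True c' [] t TN"
  have "\<sigma> = TN" using ty assms(1) by (auto simp: cstrict_def elim: ctyping_elims)
  then have "col True c' [] t' TN" using 1 assms(4) c'(1) col_promote by blast
  then show ?thesis using c'(2) col_strict[OF assms(1)] ty \<open>\<sigma> = TN\<close> by blast
qed

text \<open>Unboxing the partial conditional with \<open>q\<close> pending brings both branches to
  one colour. The conditional has the same type N as its branches, so either can be returned to
  colour \<open>c\<close>.\<close>

lemma col_branches:
  assumes "col True c [] (CApp (CApp (CApp CIfz n) p) q) \<tau>" "col_fin c"
  shows "col True c [] p \<tau>" "col True c [] q \<tau>"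
proof -
  from col_ctyping[OF assms(1)] have ty: "\<tau> = TN" "ctyping base_env [] p TN" "ctyping base_env [] q TN"
    by (auto elim!: ctyping_elims)
  from assms have "col True c [] p \<tau> \<and> col True c [] q \<tau>"
  proof (rule unbox_App)
    fix c' \<sigma> assume c': "col_fin c'" "\<And>N. col True c' [] N \<tau> \<Longrightarrow> col True c [] N \<tau>"
      and "col True c' [] (CApp (CApp CIfz n) p) (TFun \<sigma> \<tau>) \<and> col False c' [] q \<sigma> \<or>
        cstrict (CApp (CApp CIfz n) p) \<and> col True c' [] q TN"
    then have 1: "col True c' [] (CApp (CApp CIfz n) p) (TFun \<sigma> \<tau>)" "col False c' [] q \<sigma>"
      by (auto simp: cstrict_def)
    from 1 c'(1) show ?thesis
    proof (rule unbox_head)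
      fix c'' assume c'': "core c'' (CApp (CApp CIfz n) p) (TFun \<sigma> \<tau>)" "col False c'' [] q \<sigma>"
        "\<And>N. col True c'' [] N \<tau> \<Longrightarrow> col True c' [] N \<tau>"
      then obtain \<sigma>' where "col False c'' [] p \<sigma>'" by (auto simp: core_def cstrict_def)
      then have "col False c'' [] p TN" "col False c'' [] q TN"
        using c''(2) ty ctyping_unique col_ctyping by metis+
      then show ?thesis using c'(2) c''(3) ty(1) col_promote by blast
    qed
  qed
  then show "col True c [] p \<tau>" "col True c [] q \<tau>" by auto
qed

lemma col_cstep: "cstep M M' \<Longrightarrow> col True c [] M \<tau> \<Longrightarrow> col_fin c \<Longrightarrow> col True c [] M' \<tau>"
proof (induction arbitrary: c \<tau> rule: cstep.induct)
  case (c_beta \<sigma>' b t)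
  from c_beta show ?case
  proof (rule unbox_App)
    fix c' \<sigma> assume c': "col_fin c'" "\<And>N. col True c' [] N \<tau> \<Longrightarrow> col True c [] N \<tau>"
      and "col True c' [] (CLam \<sigma>' b) (TFun \<sigma> \<tau>) \<and> col False c' [] t \<sigma> \<or> cstrict (CLam \<sigma>' b) \<and> col True c' [] t TN"
    then have 1: "col True c' [] (CLam \<sigma>' b) (TFun \<sigma> \<tau>)" "col False c' [] t \<sigma>" by (auto simp: cstrict_def)
    from 1 c'(1) show ?thesis
    proof (rule unbox_head)
      fix c'' assume c'': "core c'' (CLam \<sigma>' b) (TFun \<sigma> \<tau>)" "col False c'' [] t \<sigma>"
        "\<And>N. col True c'' [] N \<tau> \<Longrightarrow> col True c' [] N \<tau>"
      \<comment> \<open>Body and argument now share the colour \<open>c''\<close>, so the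
        substitution stays within one colour.\<close>
      then have "col False c'' [] (csubst b 0 t) \<tau>"
        using col_subst[of False c'' "[\<sigma>]" b \<tau> "[]" \<sigma> t] by (auto simp: core_def)
      then show ?thesis using c'' c' col_promote by blast
    qed
  qed
next
  case (c_app s s' t)
  from c_app.prems show ?case
  proof (rule unbox_App)
    fix c' \<sigma> assume c': "col_fin c'" "\<And>N. col True c' [] N \<tau> \<Longrightarrow> col True c [] N \<tau>"
      and "col True c' [] s (TFun \<sigma> \<tau>) \<and> col False c' [] t \<sigma> \<or> cstrict s \<and> col True c' [] t TN"
    then have "col True c' [] s (TFun \<sigma> \<tau>)" "col False c' [] t \<sigma>"
      using c_app.hyps by (auto simp: cstrict_def elim: cstep_constE)
    then show ?thesis using c_app.IH c' col_App by blast
  qed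
next
  case (c_ifz0 p q)
  then show ?case using col_branches by blast
next
  case (c_ifzS n p q)
  then show ?case using col_branches by blast
next
  case (c_suc_arg t t')
  show ?case by (rule col_strict_arg[OF _ c_suc_arg.prems c_suc_arg.IH]) (auto simp: cstrict_def)
next
  case (c_pre_arg t t')
  show ?case by (rule col_strict_arg[OF _ c_pre_arg.prems c_pre_arg.IH]) (auto simp: cstrict_def)
next
  case (c_ifz_arg t t')
  show ?case by (rule col_strict_arg[OF _ c_ifz_arg.prems c_ifz_arg.IH]) (auto simp: cstrict_def)
next
  case (c_orc_arg t t' f)
  show ?case by (rule col_strict_arg[OF _ c_orc_arg.prems c_orc_arg.IH]) (auto simp: cstrict_def)
next
  case (c_Y \<sigma>' t)
  from c_Y show ?case
  proof (rule unbox_App)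
    fix c' \<sigma> assume c': "col_fin c'" "\<And>N. col True c' [] N \<tau> \<Longrightarrow> col True c [] N \<tau>"
      and 1: "col True c' [] (CY \<sigma>') (TFun \<sigma> \<tau>) \<and> col False c' [] t \<sigma> \<or> cstrict (CY \<sigma>') \<and> col True c' [] t TN"
      and ty: "ctyping base_env [] (CY \<sigma>') (TFun \<sigma> \<tau>)"
    from ty have "\<sigma> = TFun \<tau> \<tau>" "\<sigma>' = \<tau>" by (auto elim: ctyping_elims)
    then have "col False c' [] (CApp t (CApp (CY \<sigma>') t)) \<tau>" using 1
      by (auto simp: cstrict_def intro!: col.intros)
    then show ?thesis using c' col_promote by blast
  qed
qed (auto dest!: col_ctyping elim!: ctyping_elims intro: col.intros)

lemma col_csteps: "cstep\<^sup>*\<^sup>* M M' \<Longrightarrow> col True c [] M \<tau> \<Longrightarrow> col_fin c \<Longrightarrow> col True c [] M' \<tau>"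
  by (induction rule: rtranclp_induct) (auto intro: col_cstep)

section \<open>The arguments of a call and their factorization\<close>

lemma col_spine:
  "col True c [] (foldl CApp (Cst 0) Ps) (arrows \<sigma>s \<tau>) \<Longrightarrow> col_fin c \<Longrightarrow>
    list_all2 (col False c []) ts \<sigma>s \<Longrightarrow>
    \<exists>S \<sigma>s'. col_fin (Some S) \<and> arrows \<sigma>s' \<tau> = fun_ty \<and> list_all2 (col False (Some S) []) (Ps @ ts) \<sigma>s'"
proof (induction Ps arbitrary: c \<sigma>s ts rule: rev_induct)
  case Nil
  have "col_le c c" by (cases c) auto
  then obtain c' where c': "core c' (Cst 0) (arrows \<sigma>s \<tau>)" "col_fin c'" "list_all2 (col False c' []) ts \<sigma>s"
    using unbox[OF Nil(1), of \<sigma>s \<tau> c ts] Nil by auto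
  moreover have "arrows \<sigma>s \<tau> = fun_ty"
    using col_ctyping[OF Nil(1)] by (auto elim!: ctyping_elims simp: base_env_def)
  \<comment> \<open>\<open>core\<close> excludes colour \<open>None\<close> for
    \<open>Cst 0\<close>: calls of X are issued by inner code.\<close>
  moreover from c'(1) obtain S where "c' = Some S" by (auto simp: core_def)
  ultimately show ?case by (metis append_Nil)
next
  case (snoc P Ps)
  have "col_le c c" by (cases c) auto
  then obtain c' where c': "core c' (CApp (foldl CApp (Cst 0) Ps) P) (arrows \<sigma>s \<tau>)" "col_fin c'"
    "list_all2 (col False c' []) ts \<sigma>s"
    using unbox[OF snoc.prems(1), of \<sigma>s \<tau> c ts] snoc.prems by auto
  then obtain \<sigma> where "col True c' [] (foldl CApp (Cst 0) Ps) (TFun \<sigma> (arrows \<sigma>s \<tau>))" "col False c' [] P \<sigma>"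
    by (auto simp: core_def spine_not_strict)
  then show ?case using snoc.IH[of c' "\<sigma> # \<sigma>s" "P # ts"] c' by (simp add: arrows_def)
qed

text \<open>The arguments may have been supplied in different colours; \<open>col_spine\<close>
  carries all of them to the colour of the code that mentions X.\<close>

lemma col_call:
  "call 0 Ps M \<Longrightarrow> col True c [] M \<tau> \<Longrightarrow> col_fin c \<Longrightarrow>
    \<exists>S. col_fin (Some S) \<and> (\<forall>P \<in> set Ps. col False (Some S) [] P arg_ty)"
proof (induction arbitrary: c \<tau> rule: call.induct)
  case ca_here
  then obtain S \<sigma>s where S: "col_fin (Some S)" "arrows \<sigma>s \<tau> = fun_ty" "list_all2 (col False (Some S) []) Ps \<sigma>s"
    using col_spine[of c Ps "[]" \<tau> "[]"] by (auto simp: arrows_def)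
  have "\<sigma>s @ args \<tau> = replicate (Suc l) arg_ty"
    using S(2) args_arrows by (metis append_Nil2 args.simps(1) fun_ty_def)
  then have "set \<sigma>s \<subseteq> {arg_ty}" by (metis Un_upper1 set_append set_replicate_Suc)
  then have "col False (Some S) [] P arg_ty" if "P \<in> set Ps" for P
    using S(3) that by (metis in_set_conv_nth list_all2_conv_all_nth nth_mem singletonD subsetD)
  then show ?case using S(1) by blast
next
  case (ca_head M N)
  from ca_head.prems show ?case
    by (rule unbox_App) (use ca_head.IH call_not_strict[OF ca_head.hyps] in blast)
next
  case (ca_arg M f)
  from ca_arg.prems show ?case
    by (rule unbox_App) (use ca_arg.IH col_promote in blast)
qed

text \<open>At flag \<open>False\<close> each outermost foreign subterm of \<open>M\<close> belongs
  to \<open>S\<close>, hence to \<open>Qs\<close>, and becomes a constant. Once X is fixed to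
  \<open>K\<close>, the rest is a term in these constants alone.\<close>

lemma col_factor:
  assumes Qs: "set Qs = {Q \<in> S. \<exists>\<tau>. col False None [] Q \<tau> \<and> sublevel_le \<tau> m l}"
    and \<tau>s: "length \<tau>s = length Qs" "\<And>i. i < length Qs \<Longrightarrow> ctyping base_env [] (Qs ! i) (\<tau>s ! i)"
    and K: "typing [] K fun_ty"
  shows "col e c \<Gamma> M \<tau> \<Longrightarrow> \<not> e \<Longrightarrow> c = Some S \<Longrightarrow>
    \<exists>p. ctyping (list_env \<tau>s) \<Gamma> p \<tau> \<and> (\<forall>\<theta>. \<theta> 0 = K \<longrightarrow> inst \<theta> M = inst (\<lambda>i. inst \<theta> (Qs ! i)) p)"
proof (induction rule: col.induct)
  case (col_Var i \<Gamma> e c)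
  then show ?case by (intro exI[of _ "CVar i"]) (auto intro: ctyping.intros)
next
  case (col_Lam c \<sigma> \<Gamma> t \<tau> e)
  then obtain p where "ctyping (list_env \<tau>s) (\<sigma> # \<Gamma>) p \<tau>"
    "\<forall>\<theta>. \<theta> 0 = K \<longrightarrow> inst \<theta> t = inst (\<lambda>i. inst \<theta> (Qs ! i)) p" by auto
  then show ?case by (intro exI[of _ "CLam \<sigma> p"]) (auto intro: ctyping.intros)
next
  case (col_App e c \<Gamma> s \<sigma> \<tau> t)
  then obtain p q where "ctyping (list_env \<tau>s) \<Gamma> p (TFun \<sigma> \<tau>)" "ctyping (list_env \<tau>s) \<Gamma> q \<sigma>"
    "\<forall>\<theta>. \<theta> 0 = K \<longrightarrow> inst \<theta> s = inst (\<lambda>i. inst \<theta> (Qs ! i)) p"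
    "\<forall>\<theta>. \<theta> 0 = K \<longrightarrow> inst \<theta> t = inst (\<lambda>i. inst \<theta> (Qs ! i)) q" by auto
  then show ?case by (intro exI[of _ "CApp p q"]) (auto intro: ctyping.intros)
next
  case (col_fun e S' \<Gamma>)
  then show ?case
    using ctyping_weaken[OF ctyping_emb[OF K], of _ \<Gamma>] by (intro exI[of _ "emb K"]) auto
next
  case (col_outer e M \<tau> S' \<Gamma>)
  then have "M \<in> set Qs" using Qs by auto
  then obtain i where i: "i < length Qs" "Qs ! i = M" by (auto simp: in_set_conv_nth)
  then have "\<tau>s ! i = \<tau>" using ctyping_unique[OF \<tau>s(2)[OF i(1)]] col_ctyping[OF col_outer.hyps(1)] by simp
  then show ?case
    using i \<tau>s(1) by (intro exI[of _ "Cst i"]) (auto intro!: ctyping.C_Cst simp: list_env_def)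
next
  case (col_Num e c \<Gamma> n)
  show ?case by (intro exI[of _ "CNum n"]) (auto intro: ctyping.intros)
next
  case (col_Suc e c \<Gamma>)
  show ?case by (intro exI[of _ CSuc]) (auto intro: ctyping.intros)
next
  case (col_Pre e c \<Gamma>)
  show ?case by (intro exI[of _ CPre]) (auto intro: ctyping.intros)
next
  case (col_Ifz e c \<Gamma>)
  show ?case by (intro exI[of _ CIfz]) (auto intro: ctyping.intros)
next
  case (col_Y e c \<Gamma> \<sigma>)
  show ?case by (intro exI[of _ "CY \<sigma>"]) (auto intro: ctyping.intros)
next
  case (col_Orc e c \<Gamma> f)
  show ?case by (intro exI[of _ "COrc f"]) (auto intro: ctyping.intros)
qed auto

end

section \<open>Descending one level\<close>

text \<open>Pseudo-retractions given by terms with holes instead of closed functions; this avoids having to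
  compare \<open>\<beta>\<close>-convertible terms.\<close>
definition open_retract :: "ty \<Rightarrow> ty list \<Rightarrow> bool" where
  "open_retract \<rho> \<sigma>s \<longleftrightarrow>
     (\<exists>p Qs. length Qs = length \<sigma>s \<and> ctyping (list_env \<sigma>s) [] p \<rho>
        \<and> (\<forall>i < length \<sigma>s. ctyping (list_env [\<rho>]) [] (Qs ! i) (\<sigma>s ! i))
        \<and> (\<forall>z. typing [] z \<rho> \<longrightarrow> sf_le \<rho> z (inst (\<lambda>i. inst (\<lambda>_. z) (Qs ! i)) p)))"

lemma pseudo_retract_imp_open_retract:
  assumes "pseudo_retract \<rho> \<sigma>s"
  shows "open_retract \<rho> \<sigma>s"
proof -
  from assms obtain ts r where ts: "length ts = length \<sigma>s"
      "\<forall>i < length \<sigma>s. typing [] (ts ! i) (TFun \<rho> (\<sigma>s ! i))"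
    and r: "typing [] r (arrows \<sigma>s \<rho>)"
    and le: "\<forall>f. typing [] f \<rho> \<longrightarrow> sf_le \<rho> f (foldl App r (map (\<lambda>t. App t f) ts))"
    by (auto simp: pseudo_retract_def)
  let ?p = "foldl CApp (emb r) (map Cst [0..<length \<sigma>s])"
  let ?Qs = "map (\<lambda>t. CApp (emb t) (Cst 0)) ts"
  have "ctyping (list_env \<sigma>s) [] ?p \<rho>"
    by (rule ctyping_foldl[OF ctyping_emb[OF r]])
      (auto simp: list_all2_conv_all_nth list_env_def intro!: ctyping.C_Cst)
  moreover have "ctyping (list_env [\<rho>]) [] (?Qs ! i) (\<sigma>s ! i)" if "i < length \<sigma>s" for i
    using that ts by (auto simp: list_env_def intro!: ctyping.C_App[OF ctyping_emb] ctyping.C_Cst)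
  moreover have "inst (\<lambda>i. inst (\<lambda>_. z) (?Qs ! i)) ?p = foldl App r (map (\<lambda>t. App t z) ts)" for z
  proof -
    have "map (\<lambda>i. inst (\<lambda>_. z) (?Qs ! i)) [0..<length \<sigma>s] = map (\<lambda>t. App t z) ts"
      using ts(1) by (intro nth_equalityI) auto
    then show ?thesis by (simp add: inst_foldl comp_def)
  qed
  ultimately show ?thesis using le ts(1) unfolding open_retract_def by (metis length_map)
qed

text \<open>The default \<open>Num 0\<close> keeps the environment closed at indices beyond X and
  the Z_i.\<close>

definition assign :: "tm \<Rightarrow> tm list \<Rightarrow> nat \<Rightarrow> tm" where
  "assign f zs i = (case i of 0 \<Rightarrow> f | Suc j \<Rightarrow> if j < length zs then zs ! j else Num 0)"

lemma closed_assign: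
  assumes "closed f" "\<forall>z \<in> set zs. closed z"
  shows "closed_env (assign f zs)"
  using assms by (auto simp: closed_env_def assign_def closed_def split: nat.split)

section \<open>The descent from level \<open>m + 1\<close> to level \<open>m\<close>\<close>

context factoring
begin

lemma fun_ty_eq: "rho (Suc m) (Suc l) = fun_ty"
  by (simp add: fun_ty_def arrows_def)

lemma col_of_ctyping:
  "ctyping D \<Gamma> M \<tau> \<Longrightarrow> D = list_env [fun_ty] \<Longrightarrow> col False (Some S) \<Gamma> M \<tau>"
  by (induction rule: ctyping.induct) (auto intro: col.intros simp: list_env_def split: if_splits)

lemma inner_ok_if_sublevel: "sublevel_le \<sigma> (Suc m) l \<Longrightarrow> inner_ok m l \<sigma>"
  unfolding inner_ok_def
proof
  fix \<tau> assume "sublevel_le \<sigma> (Suc m) l" "\<tau> \<in> set (args \<sigma>)"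
  then show "sublevel_le \<tau> m l"
    using lv_args[of \<tau> \<sigma>] by (auto simp: sublevel_le_def)
qed

text \<open>For \<open>m = 0\<close>, a type of level 1 has at most \<open>l\<close> arguments by
  its width; here the width bound enters the count.\<close>

lemma box_count_if_sublevel:
  assumes "sublevel_le \<sigma> (Suc m) l"
  shows "box_count m l {} \<sigma>"
  using assms length_args_le_width[of \<sigma>] lv_0[of \<sigma>]
  by (auto simp: box_count_def sublevel_le_def)

lemma col_cinst:
  "ctyping D \<Gamma> p \<tau> \<Longrightarrow> (\<And>i \<sigma>. D i = Some \<sigma> \<Longrightarrow> col False c [] (\<phi> i) \<sigma>) \<Longrightarrow> col False c \<Gamma> (cinst \<phi> p) \<tau>"
proof (induction rule: ctyping.induct)
  case (C_Cst i \<tau> \<Gamma>)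
  then show ?case using col_weaken[of False c "[]" _ _ \<Gamma>] by simp
qed (auto intro: col.intros)

lemma col_foldl:
  "col False c \<Gamma> s (arrows \<sigma>s \<tau>) \<Longrightarrow> list_all2 (col False c \<Gamma>) ts \<sigma>s \<Longrightarrow> col False c \<Gamma> (foldl CApp s ts) \<tau>"
proof (induction ts arbitrary: s \<sigma>s)
  case (Cons t ts)
  then obtain \<sigma> \<sigma>s' where "\<sigma>s = \<sigma> # \<sigma>s'" by (cases \<sigma>s) auto
  then show ?case using Cons by (auto simp: arrows_def intro: col_App)
qed (simp add: arrows_def)

abbreviation const_fun :: "nat \<Rightarrow> tm" where
  "const_fun n \<equiv> lams (replicate (Suc l) arg_ty) (Num n)"

lemma typing_const_fun: "typing [] (const_fun n) fun_ty"
  unfolding fun_ty_def by (intro typing_lams typing.T_Num)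

text \<open>The constants 1 to \<open>l + 1\<close> are Z_0 to Z_l, as \<open>Cst 0\<close> is
  X.\<close>

definition retract_program :: "ctm \<Rightarrow> ctm list \<Rightarrow> ctm" where
  "retract_program p Qs = foldl CApp (cinst (\<lambda>i. Qs ! i) p) (map Cst [1..<Suc (Suc l)])"

lemma inst_retract_program:
  assumes p: "ctyping (list_env \<sigma>s) [] p fun_ty"
    and Qs: "\<forall>i < length \<sigma>s. ctyping (list_env [fun_ty]) [] (Qs ! i) (\<sigma>s ! i)"
    and zs: "length zs = Suc l"
  shows "inst (assign f zs) (retract_program p Qs) = foldl App (inst (\<lambda>i. inst (\<lambda>_. f) (Qs ! i)) p) zs"
proof -
  have "inst (assign f zs) (Qs ! i) = inst (\<lambda>_. f) (Qs ! i)" if "i < length \<sigma>s" for i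
    using Qs that by (intro inst_cong[of "list_env [fun_ty]"]) (auto simp: list_env_def assign_def split: if_splits)
  then have "inst (assign f zs) (cinst (\<lambda>i. Qs ! i) p) = inst (\<lambda>i. inst (\<lambda>_. f) (Qs ! i)) p"
    unfolding inst_cinst by (intro inst_cong[OF p]) (auto simp: list_env_def split: if_splits)
  moreover have "map (inst (assign f zs)) (map Cst [1..<Suc (Suc l)]) = zs"
    using zs by (intro nth_equalityI) (auto simp: assign_def simp del: upt_Suc)
  ultimately show ?thesis unfolding retract_program_def inst_foldl by simp
qed

text \<open>Each \<open>Qs ! i\<close> is placed into the outer code as an inner box with empty set,
  since it mentions X but no Z_i.\<close>

lemma col_retract_program:
  assumes p: "ctyping (list_env \<sigma>s) [] p fun_ty"
    and Qs: "\<forall>i < length \<sigma>s. ctyping (list_env [fun_ty]) [] (Qs ! i) (\<sigma>s ! i)"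
    and sub: "\<forall>\<sigma> \<in> set \<sigma>s. sublevel_le \<sigma> (Suc m) l"
  shows "col True None [] (retract_program p Qs) TN"
proof -
  have "col False None [] (Qs ! i) (\<sigma>s ! i)" if "i < length \<sigma>s" for i
    using that Qs sub inner_ok_if_sublevel box_count_if_sublevel
    by (intro col_inner[of _ "{}"] col_of_ctyping) auto
  then have "col False None [] (cinst (\<lambda>i. Qs ! i) p) fun_ty"
    by (intro col_cinst[OF p]) (auto simp: list_env_def split: if_splits)
  moreover have "list_all2 (col False None []) (map Cst [1..<Suc (Suc l)]) (replicate (Suc l) arg_ty)"
    by (auto simp: list_all2_conv_all_nth simp del: upt_Suc replicate_Suc intro!: col_arg)
  ultimately show ?thesis
    unfolding retract_program_def by (intro col_promote[OF col_foldl]) (auto simp: fun_ty_def)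
qed

text \<open>All \<open>l + 1\<close> arguments are recovered from one common family
  \<open>Qs\<close>. Level 1 needs this joint form and the bound on the length; the induction step
  specializes it to one coordinate.\<close>

lemma factor:
  assumes "open_retract fun_ty \<sigma>s" and sub: "\<forall>\<sigma> \<in> set \<sigma>s. sublevel_le \<sigma> (Suc m) l"
  obtains \<tau>s Qs ps where "length Qs = length \<tau>s" "\<forall>\<tau> \<in> set \<tau>s. sublevel_le \<tau> m l"
    "m = 0 \<Longrightarrow> length \<tau>s \<le> l"
    "\<forall>i < length \<tau>s. ctyping base_env [] (Qs ! i) (\<tau>s ! i)"
    "\<forall>j \<le> l. ctyping (list_env \<tau>s) [] (ps j) arg_ty"
    "\<And>zs j. length zs = Suc l \<Longrightarrow> \<forall>z \<in> set zs. typing [] z arg_ty \<Longrightarrow> j \<le> l \<Longrightarrow>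
      sf_le arg_ty (zs ! j) (inst (\<lambda>i. inst (assign (const_fun 0) zs) (Qs ! i)) (ps j))"
proof -
  from assms(1) obtain p Rs where p: "ctyping (list_env \<sigma>s) [] p fun_ty"
    and Rs: "\<forall>i < length \<sigma>s. ctyping (list_env [fun_ty]) [] (Rs ! i) (\<sigma>s ! i)"
    and le: "\<And>z. typing [] z fun_ty \<Longrightarrow> sf_le fun_ty z (inst (\<lambda>i. inst (\<lambda>_. z) (Rs ! i)) p)"
    unfolding open_retract_def by blast
  define M0 where "M0 = retract_program p Rs"
  have simulate: "evals (inst (assign f zs) M0) n"
    if "typing [] f fun_ty" "length zs = Suc l" "\<forall>z \<in> set zs. typing [] z arg_ty" "evals (foldl App f zs) n" for f zs n
  proof -
    have "list_all2 (typing []) zs (replicate (Suc l) arg_ty)"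
      using that(2,3) by (auto simp: list_all2_conv_all_nth simp del: replicate_Suc)
    then show ?thesis
      unfolding M0_def inst_retract_program[OF p Rs that(2)]
      using sf_le_apply[OF le[OF that(1)] fun_ty_def _ that(4)] by blast
  qed
  have closed: "closed_env (assign f zs)"
    if "typing [] f fun_ty" "\<forall>z \<in> set zs. typing [] z arg_ty" for f zs
    using that by (intro closed_assign) (auto intro: typing_imp_closed)
  \<comment> \<open>With undefined Z_i, an evaluation that calls one of them diverges.\<close>
  define oms where "oms = replicate (Suc l) (omega arg_ty)"
  have oms: "length oms = Suc l" "\<forall>z \<in> set oms. typing [] z arg_ty"
    by (auto simp: oms_def typing_omega)
  \<comment> \<open>The constant functions do not inspect their arguments, so the first constant that the program
    calls is \<open>X\<close>.\<close>
  have const: "evals (inst (assign (const_fun n) oms) M0) n" for n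
  proof (rule simulate[OF typing_const_fun oms])
    have "step\<^sup>*\<^sup>* (foldl App (const_fun n) oms) (Num n)"
      using oms by (intro lams_closed_beta) (auto simp: closed_def[of "Num n"] typing_imp_closed simp del: replicate_Suc)
    then show "evals (foldl App (const_fun n) oms) n" by (simp add: evals_def)
  qed
  obtain M1 where M1: "cstep\<^sup>*\<^sup>* M0 M1" "M1 = CNum 0 \<or> (\<exists>j. stuck j M1)"
    using evals_inst_cases[OF closed[OF typing_const_fun oms(2)] const] by blast
  have evals_M1: "evals (inst \<theta> M1) n" if "evals (inst \<theta> M0) n" "closed_env \<theta>" for \<theta> n
    using that evals_steps[OF csteps_inst[OF M1(1)]] by blast
  have col: "col True None [] M1 TN"
    using col_csteps[OF M1(1)] col_retract_program[OF p Rs sub] by (simp add: M0_def)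
  \<comment> \<open>The same symbolic reduct must yield 1 when X is constantly 1.\<close>
  have "M1 \<noteq> CNum 0"
    using evals_M1[OF const[of 1]] closed[OF typing_const_fun oms(2)] by (auto simp: evals_Num)
  then obtain j where j: "stuck j M1" using M1(2) by blast
  have "j = 0"
  proof (rule ccontr)
    assume "j \<noteq> 0"
    moreover have "base_env j \<noteq> None" using stuck_typed[OF j col_ctyping[OF col]] .
    ultimately have "assign (const_fun 0) oms j = omega arg_ty"
      by (auto simp: base_env_def assign_def oms_def split: nat.split if_splits simp del: replicate_Suc)
    then have "in_eval_pos (omega arg_ty) (inst (assign (const_fun 0) oms) M1)"
      using stuck_inst[OF j, of "assign (const_fun 0) oms"] by simp
    from in_eval_pos_val[OF this evals_M1[OF const]] show False
      using closed[OF typing_const_fun oms(2)] omega_not_val by blast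
  qed
  \<comment> \<open>A call of X lacking arguments would not have type N.\<close>
  have "TN \<noteq> arrows (drop n (replicate (Suc l) arg_ty)) TN" if "n < Suc l" for n
    using that args_arrows[of "drop n (replicate (Suc l) arg_ty)" TN]
    by (auto simp del: replicate_Suc)
  then obtain Ps where Ps: "length Ps = Suc l" "call 0 Ps M1"
    using stuck_full[of base_env 0 "replicate (Suc l) arg_ty" M1 TN] j \<open>j = 0\<close> col_ctyping[OF col]
    by (auto simp: base_env_def fun_ty_def simp del: replicate_Suc drop_replicate)
  obtain S where S: "col_fin (Some S)" "\<forall>P \<in> set Ps. col False (Some S) [] P arg_ty"
    using col_call[OF Ps(2) col] by auto
  have S_fin: "finite S" "m = 0 \<Longrightarrow> card S \<le> l"
    using S(1) unfolding col_fin.simps by blast+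
  let ?ok = "\<lambda>Q \<tau>. col False None [] Q \<tau> \<and> sublevel_le \<tau> m l"
  \<comment> \<open>\<open>S\<close> may contain terms that cannot serve as foreign subterms; those
    kept here can be given a type.\<close>
  let ?S = "{Q \<in> S. \<exists>\<tau>. ?ok Q \<tau>}"
  have "finite ?S" using S_fin(1) by simp
  from finite_distinct_list[OF this] obtain Qs where Qs: "set Qs = ?S" "distinct Qs" by (elim exE conjE)
  define \<tau>s where "\<tau>s = map (\<lambda>Q. SOME \<tau>. ?ok Q \<tau>) Qs"
  have \<tau>s_len: "length \<tau>s = length Qs" by (simp add: \<tau>s_def)
  have \<tau>s: "?ok (Qs ! i) (\<tau>s ! i)" if "i < length Qs" for i
  proof -
    have "\<exists>\<tau>. ?ok (Qs ! i) \<tau>" using nth_mem[OF that] unfolding Qs(1) by simp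
    from someI_ex[OF this] show ?thesis using that by (simp add: \<tau>s_def)
  qed
  have "\<exists>q. ctyping (list_env \<tau>s) [] q arg_ty \<and>
      (\<forall>\<theta>. \<theta> 0 = const_fun 0 \<longrightarrow> inst \<theta> (Ps ! j) = inst (\<lambda>i. inst \<theta> (Qs ! i)) q)" if "j \<le> l" for j
  proof (rule col_factor[OF Qs(1) \<tau>s_len _ typing_const_fun _ _ refl])
    show "ctyping base_env [] (Qs ! i) (\<tau>s ! i)" if "i < length Qs" for i
      using \<tau>s[OF that] col_ctyping by blast
    show "col False (Some S) [] (Ps ! j) arg_ty" using S(2) Ps(1) that by simp
  qed simp
  then obtain ps where ps: "\<forall>j\<le>l. ctyping (list_env \<tau>s) [] (ps j) arg_ty \<and>
      (\<forall>\<theta>. \<theta> 0 = const_fun 0 \<longrightarrow> inst \<theta> (Ps ! j) = inst (\<lambda>i. inst \<theta> (Qs ! i)) (ps j))"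
    by metis
  show thesis
  proof (rule that)
    show "length Qs = length \<tau>s" by (simp add: \<tau>s_len)
    show "\<forall>\<tau> \<in> set \<tau>s. sublevel_le \<tau> m l" using \<tau>s \<tau>s_len by (metis in_set_conv_nth)
    show "length \<tau>s \<le> l" if "m = 0"
    proof -
      have "length Qs = card ?S" using Qs distinct_card by metis
      also have "\<dots> \<le> card S" using S_fin(1) by (intro card_mono) auto
      finally show ?thesis using S_fin(2)[OF that] \<tau>s_len by simp
    qed
    show "\<forall>i < length \<tau>s. ctyping base_env [] (Qs ! i) (\<tau>s ! i)" using \<tau>s \<tau>s_len col_ctyping by metis
    show "\<forall>j \<le> l. ctyping (list_env \<tau>s) [] (ps j) arg_ty" using ps by blast
    fix zs j assume zs: "length zs = Suc l" "\<forall>z \<in> set zs. typing [] z arg_ty" and j: "j \<le> l"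
    let ?\<psi> = "assign (const_fun 0) zs"
    \<comment> \<open>With the test \<open>f z = (if h z\<^sub>j = n then 0)\<close> for \<open>X\<close> the first call must return, so the test
      accepts its \<open>j\<close>-th argument; replacing the test by the larger constant function makes this
      argument independent of \<open>h\<close>.\<close>
    have "evals (App h (inst ?\<psi> (Ps ! j))) n" if h: "typing [] h (TFun arg_ty TN)" "evals (App h (zs ! j)) n" for h n
    proof -
      define g where "g = (\<lambda>i. if i = n then Some (0::nat) else None)"
      \<comment> \<open>Index \<open>l - j\<close> selects the \<open>j\<close>-th of the
        \<open>l + 1\<close> abstracted arguments.\<close>
      define f where "f = lams (replicate (Suc l) arg_ty) (App (Orc g) (App h (Var (l - j))))"
      have [simp]: "closed (Orc g)" "closed h"
        using typing_imp_closed h(1) by (auto simp: closed_def[of "Orc g"])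
      have f: "typing [] f fun_ty"
        unfolding f_def fun_ty_def
      proof (rule typing_lams)
        let ?\<Gamma> = "rev (replicate (Suc l) arg_ty) @ []"
        have "typing ?\<Gamma> (Var (l - j)) arg_ty"
          using typing.T_Var[of "l - j" ?\<Gamma>] by (simp del: replicate_Suc)
        then show "typing ?\<Gamma> (App (Orc g) (App h (Var (l - j)))) TN"
          using typing_weaken[OF h(1), of ?\<Gamma>] by (auto intro: typing.intros simp del: replicate_Suc)
      qed
      have proj: "step\<^sup>*\<^sup>* (foldl App f ts) (App (Orc g) (App h (ts ! j)))"
        if "length ts = Suc l" "\<forall>t \<in> set ts. closed t" for ts
        using lams_proj_beta[of "Orc g" h j "replicate (Suc l) arg_ty" ts] that j
        by (simp add: f_def del: replicate_Suc)
      have "step\<^sup>*\<^sup>* (App (Orc g) (App h (zs ! j))) (App (Orc g) (Num n))"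
        using h(2) by (intro steps_strict_arg) (auto simp: evals_def strict_def)
      moreover have "step (App (Orc g) (Num n)) (Num 0)" by (simp add: s_orc g_def)
      ultimately have "evals (foldl App f zs) 0"
        using evals_steps[OF proj[OF zs(1)]] evals_steps evals_step evals_Num typing_imp_closed zs(2) by metis
      then have ev: "evals (inst (assign f zs) M1) 0"
        using evals_M1 simulate[OF f zs] closed[OF f zs(2)] by blast
      let ?\<theta> = "assign f zs"
      let ?Ps = "map (inst ?\<theta>) Ps"
      have "typing [] (inst ?\<theta> P) arg_ty" if "P \<in> set Ps" for P
        using col_ctyping S(2) that f zs
        by (intro typing_inst[of base_env]) (auto simp: base_env_def assign_def split: if_splits nat.split)
      then have clP: "\<forall>t \<in> set ?Ps. closed t" using typing_imp_closed by auto
      \<comment> \<open>The call must reach a value for the program to evaluate. It reduces to the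
        oracle applied to \<open>App h (?Ps ! j)\<close>, which therefore evaluates to
        \<open>n\<close>, the only point where \<open>g\<close> is defined.\<close>
      have "in_eval_pos (foldl App f ?Ps) (inst ?\<theta> M1)"
        using call_inst[OF Ps(2), of ?\<theta>] by (simp add: assign_def)
      from in_eval_pos_val[OF this ev] obtain V where "step\<^sup>*\<^sup>* (App (Orc g) (App h (?Ps ! j))) V" "val V"
        using val_steps[OF proj[OF _ clP]] Ps(1) by auto
      from orc_val[OF this] have ev_h: "evals (App h (inst ?\<theta> (Ps ! j))) n"
        using Ps(1) j by (auto simp: g_def split: if_splits)
      have "sim f (const_fun 0)"
        unfolding f_def by (intro sim_lams sim_orc) (auto simp: ran_def g_def)
      then have "sim (?\<theta> i) (?\<psi> i)" for i
        by (auto simp: assign_def sim_refl split: nat.split)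
      then have "sim (App h (inst ?\<theta> (Ps ! j))) (App h (inst ?\<psi> (Ps ! j)))"
        by (rule sim_App[OF sim_refl sim_inst])
      from sim_evals[OF this ev_h] show ?thesis .
    qed
    then show "sf_le arg_ty (zs ! j) (inst (\<lambda>i. inst ?\<psi> (Qs ! i)) (ps j))"
      using ps j by (auto simp: sf_le_def assign_def[of _ _ 0])
  qed
qed

text \<open>Setting every Z_i to the same \<open>z\<close> and X to the constant function turns
  \<open>Qs\<close> into terms with one hole; \<open>ps 0\<close> then reconstructs
  \<open>z\<close>.\<close>

lemma factor_single:
  assumes "open_retract fun_ty \<sigma>s" "\<forall>\<sigma> \<in> set \<sigma>s. sublevel_le \<sigma> (Suc m) l"
  shows "\<exists>\<tau>s. open_retract arg_ty \<tau>s \<and> (\<forall>\<tau> \<in> set \<tau>s. sublevel_le \<tau> m l)"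
  using assms
proof (rule factor)
  fix \<tau>s Qs ps
  assume len: "length Qs = length \<tau>s" and sub: "\<forall>\<tau> \<in> set \<tau>s. sublevel_le \<tau> m l"
    and Qs: "\<forall>i < length \<tau>s. ctyping base_env [] (Qs ! i) (\<tau>s ! i)"
    and ps: "\<forall>j \<le> l. ctyping (list_env \<tau>s) [] (ps j) arg_ty"
    and le: "\<And>zs j. length zs = Suc l \<Longrightarrow> \<forall>z \<in> set zs. typing [] z arg_ty \<Longrightarrow> j \<le> l \<Longrightarrow>
      sf_le arg_ty (zs ! j) (inst (\<lambda>i. inst (assign (const_fun 0) zs) (Qs ! i)) (ps j))"
  define \<phi> where "\<phi> j = (if j = 0 then emb (const_fun 0) else Cst 0)" for j :: nat
  have "ctyping (list_env [arg_ty]) [] (map (cinst \<phi>) Qs ! i) (\<tau>s ! i)" if "i < length \<tau>s" for i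
  proof -
    have "ctyping (list_env [arg_ty]) [] (\<phi> j) \<sigma>" if "base_env j = Some \<sigma>" for j \<sigma>
      using that ctyping_emb[OF typing_const_fun]
      by (auto simp: base_env_def \<phi>_def list_env_def intro!: ctyping.C_Cst split: if_splits)
    then show ?thesis using that Qs len by (auto intro: ctyping_cinst)
  qed
  moreover have "sf_le arg_ty z (inst (\<lambda>i. inst (\<lambda>_. z) (map (cinst \<phi>) Qs ! i)) (ps 0))" if z: "typing [] z arg_ty" for z
  proof -
    let ?zs = "replicate (Suc l) z"
    have "inst (\<lambda>i. inst (\<lambda>_. z) (map (cinst \<phi>) Qs ! i)) (ps 0)
      = inst (\<lambda>i. inst (assign (const_fun 0) ?zs) (Qs ! i)) (ps 0)"
    proof (rule inst_cong)
      show "ctyping (list_env \<tau>s) [] (ps 0) arg_ty" using ps by simp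
      fix i \<sigma> assume "list_env \<tau>s i = Some \<sigma>"
      then have i: "i < length \<tau>s" by (simp add: list_env_def split: if_splits)
      have "inst (\<lambda>j. inst (\<lambda>_. z) (\<phi> j)) (Qs ! i) = inst (assign (const_fun 0) ?zs) (Qs ! i)"
        using Qs i by (intro inst_cong[of base_env])
          (auto simp: base_env_def \<phi>_def assign_def split: if_splits nat.split simp del: replicate_Suc)
      then show "inst (\<lambda>_. z) (map (cinst \<phi>) Qs ! i) = inst (assign (const_fun 0) ?zs) (Qs ! i)"
        using i len by (simp add: inst_cinst)
    qed
    then show ?thesis using le[of ?zs 0] z by simp
  qed
  ultimately have "open_retract arg_ty \<tau>s"
    unfolding open_retract_def using ps len
    by (intro exI[of _ "ps 0"] exI[of _ "map (cinst \<phi>) Qs"]) auto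
  then show ?thesis using sub by blast
qed

end

section \<open>Level 1 and the theorem\<close>

lemma not_open_retract_1:
  assumes "\<forall>\<sigma> \<in> set \<sigma>s. sublevel_le \<sigma> 1 l"
  shows "\<not> open_retract (rho 1 (Suc l)) \<sigma>s"
proof
  interpret factoring 0 l .
  assume "open_retract (rho 1 (Suc l)) \<sigma>s"
  then have "open_retract fun_ty \<sigma>s" using fun_ty_eq by simp
  moreover have "\<forall>\<sigma> \<in> set \<sigma>s. sublevel_le \<sigma> (Suc 0) l" using assms by simp
  ultimately show False
  proof (rule factor)
    fix \<tau>s Qs ps
    assume len: "length Qs = length \<tau>s" and sub: "\<forall>\<tau> \<in> set \<tau>s. sublevel_le \<tau> 0 l"
      and "0 = (0::nat) \<Longrightarrow> length \<tau>s \<le> l"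
      and Qs: "\<forall>i < length \<tau>s. ctyping base_env [] (Qs ! i) (\<tau>s ! i)"
      and ps: "\<forall>j \<le> l. ctyping (list_env \<tau>s) [] (ps j) (rho 0 (Suc l))"
      and le: "\<And>zs j. length zs = Suc l \<Longrightarrow> \<forall>z \<in> set zs. typing [] z (rho 0 (Suc l)) \<Longrightarrow> j \<le> l \<Longrightarrow>
        sf_le (rho 0 (Suc l)) (zs ! j) (inst (\<lambda>i. inst (assign (const_fun 0) zs) (Qs ! i)) (ps j))"
    then have len_le: "length \<tau>s \<le> l" by simp
    have \<tau>s: "\<tau>s ! i = TN" if "i < length \<tau>s" for i
      using sub lv_0 nth_mem[OF that] by (fastforce simp: sublevel_le_def)
    \<comment> \<open>Appending an element to \<open>as\<close> makes exactly one more input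
      defined, up to all \<open>l + 1\<close>.\<close>
    define zs where "zs as = map Num as @ replicate (Suc l - length as) (omega TN)" for as
    define q where "q as i = inst (assign (const_fun 0) (zs as)) (Qs ! i)" for as i
    \<comment> \<open>These are the intermediate values made defined by the inputs. The set grows
      with \<open>as\<close>, and it has at most \<open>l\<close> elements.\<close>
    define D where "D as = {i. i < length \<tau>s \<and> (\<exists>n. evals (q as i) n)}" for as
    have zs_ty: "\<forall>z \<in> set (zs as). typing [] z TN" for as
      by (auto simp: zs_def typing_omega typing.T_Num)
    have zs_len: "length (zs as) = Suc l" if "length as \<le> Suc l" for as
      using that by (simp add: zs_def)
    have q_ty: "typing [] (q as i) TN" if "i < length \<tau>s" "length as \<le> Suc l" for as i
    proof -
      have "ctyping base_env [] (Qs ! i) TN" using Qs \<tau>s that by auto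
      then show ?thesis
        unfolding q_def using zs_ty[of as] zs_len[OF that(2)] typing_const_fun
        by (intro typing_inst[of base_env]) (auto simp: base_env_def assign_def split: if_splits nat.split)
    qed
    have mono: "evals (q (as @ [a]) i) n" if "evals (q as i) n" "length as \<le> l" for as a i n
    proof -
      have "sim (zs as ! j) (zs (as @ [a]) ! j)" for j
        using that(2) by (auto simp: zs_def nth_append less_Suc_eq not_evals_omega typing_omega typing.T_Num
            Suc_diff_le nth_Cons' intro: sim_refl sim_base)
      then have "sim (q as i) (q (as @ [a]) i)"
        unfolding q_def using that(2)
        by (intro sim_inst) (auto simp: assign_def zs_len sim_refl split: nat.split)
      then show ?thesis using sim_evals that(1) by blast
    qed
    \<comment> \<open>Each further defined input must make a further intermediate value defined, since the next input
      is chosen different from what could be reconstructed without it.\<close>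
    have "\<exists>as. length as = i \<and> card (D as) \<ge> i" if "i \<le> Suc l" for i
      using that
    proof (induction i)
      case (Suc i)
      then obtain as where as: "length as = i" "card (D as) \<ge> i" by auto
      \<comment> \<open>If coordinate \<open>i\<close> is already reconstructed as \<open>v\<close>,
        the input \<open>Suc v\<close> differs from it; if it is undefined, any input will
        do.\<close>
      have "\<exists>a. \<not> evals (inst (q as) (ps i)) a"
      proof (cases "\<exists>v. evals (inst (q as) (ps i)) v")
        case True
        then obtain v where "evals (inst (q as) (ps i)) v" by blast
        then have "\<not> evals (inst (q as) (ps i)) (Suc v)"
          using evals_steps[of "inst (q as) (ps i)" "Num v"] by (auto simp: evals_def[of _ v] evals_Num)
        then show ?thesis by blast
      qed blast
      then obtain a where a: "\<not> evals (inst (q as) (ps i)) a" by blast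
      let ?bs = "as @ [a]"
      have sub: "D as \<subseteq> D ?bs" using mono[of as _ _ a] as(1) Suc.prems unfolding D_def by fastforce
      \<comment> \<open>If no further intermediate value became defined, all of them would be as
        before, and the reconstruction could not produce the new input \<open>a\<close>.\<close>
      have "D as \<noteq> D ?bs"
      proof
        assume eq: "D as = D ?bs"
        have "zs ?bs ! i = Num a" using as(1) by (simp add: zs_def nth_append)
        moreover have "sf_le TN (zs ?bs ! i) (inst (q ?bs) (ps i))"
          using le[OF zs_len, of ?bs i] zs_ty[of ?bs] as(1) Suc.prems unfolding q_def[abs_def] by simp
        moreover have "typing [] (Lam TN (Var 0)) (TFun TN TN)"
          using typing.T_Var[of 0 "[TN]"] by (auto intro: typing.T_Lam)
        moreover have "step (App (Lam TN (Var 0)) u) u" for u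
          using s_beta[of TN "Var 0" u] by simp
        ultimately have bs: "evals (inst (q ?bs) (ps i)) a"
          unfolding sf_le_def by (metis evals_Num evals_step)
        have same: "evals (q as b) n" if b: "b < length \<tau>s" "evals (q ?bs b) n" for b n
        proof -
          obtain n' where n': "evals (q as b) n'" using b eq by (auto simp: D_def)
          then have "evals (q ?bs b) n'" using mono as(1) Suc.prems by simp
          then have "n = n'" using b(2) evals_steps[of "q ?bs b" "Num n"] by (auto simp: evals_def[of _ n] evals_Num)
          then show ?thesis using n' by simp
        qed
        \<comment> \<open>Indices outside \<open>\<tau>s\<close> do not occur in
          \<open>ps i\<close>; sending them to \<open>Num 0\<close> gives \<open>sim\<close> at
          every index.\<close>
        let ?r = "\<lambda>as b. if b < length \<tau>s then q as b else Num 0"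
        have cong: "inst (q cs) (ps i) = inst (?r cs) (ps i)" for cs
          using ps Suc.prems by (intro inst_cong[of "list_env \<tau>s" "[]" _ TN]) (auto simp: list_env_def split: if_splits)
        have "sim (inst (?r ?bs) (ps i)) (inst (?r as) (ps i))"
          using same q_ty as(1) Suc.prems by (intro sim_inst) (auto intro: sim_refl sim_base)
        then show False using sim_evals bs a cong by metis
      qed
      then have "card (D as) < card (D ?bs)"
        using sub by (intro psubset_card_mono) (auto simp: D_def)
      then show ?case using as by (intro exI[of _ ?bs]) auto
    qed (auto)
    then obtain as where "card (D as) \<ge> Suc l" by blast
    moreover have "card (D as) \<le> card {..<length \<tau>s}" by (intro card_mono) (auto simp: D_def)
    ultimately show False using len_le by simp
  qed
qed

lemma not_open_retract:
  "\<forall>\<sigma> \<in> set \<sigma>s. sublevel_le \<sigma> (Suc m) l \<Longrightarrow> \<not> open_retract (rho (Suc m) (Suc l)) \<sigma>s"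
proof (induction m arbitrary: \<sigma>s)
  case 0
  then show ?case using not_open_retract_1[of \<sigma>s l] by simp
next
  case (Suc m)
  interpret factoring "Suc m" l .
  show ?case
    using factor_single[of \<sigma>s] Suc fun_ty_eq by metis
qed

theorem theorem6p3:
  fixes k l :: nat and \<sigma>s :: "ty list"
  assumes "k \<ge> 1" and "l \<ge> 1"
    and "\<forall>\<sigma> \<in> set \<sigma>s. sublevel_le \<sigma> k l"
  shows "\<not> pseudo_retract (rho k (l + 1)) \<sigma>s"
proof -
  obtain m where "k = Suc m" using assms(1) by (cases k) auto
  then show ?thesis
    using not_open_retract[of \<sigma>s m l] pseudo_retract_imp_open_retract assms(3) by auto
qed

end
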